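(* Let $N\subset M$ be an inclusion of II$_1$ factors of finite Jones index, with Jones projection $\mathsf p$, let $x\in N^{\perp}$, and consider the geodesic of ${\cal P}(M_1)$ given by $\gamma_x(t)=e^{t(x\mathsf p-\mathsf p x^* )}\,\mathsf p\,e^{-t(x\mathsf p-\mathsf p x^* )}$, $t\in\mathbb R$. Then $\gamma_x$ is a geodesic of ${\cal O}(\mathsf p)$ if and only if $x^*=-x$ and $x^2\in N$. In this case $$\gamma_x(t)=e^{tx}\mathsf p e^{-tx}=\mathsf p\cos^2(t|x|)+u\mathsf p u^*\sin^2(t|x|)+\tfrac12[u,\mathsf p]\sin(2t|x|),$$ where $x=u|x|$, with $u\in N^{\perp}$, $u^*=-u$, a partial isometry such that $u^*u=uu^*=-u^2\in N$, and $|x|=\sqrt{-x^2}\in N$.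
   Context: Let $N\subset M$ be II$_1$ factors with finite index, $\tau$ the normalized trace of $M$ (and of $N$), $\mathsf p:L^2(M,\tau)\to L^2(N,\tau)$ the Jones (orthogonal) projection, $E:M\to N$ the trace-preserving conditional expectation, and $M_1$ the von Neumann algebra of operators on $L^2(M,\tau)$ generated by $M$ and $\mathsf p$ (a II$_1$ factor, whose normalized trace is also denoted $\tau$). $N^\perp=\ker E\subset M$; $|x|=(x^*x)^{1/2}$; $[a,b]=ab-ba$; $x=u|x|$ is the polar decomposition. ${\cal P}(M_1)$ is the manifold of selfadjoint projections of $M_1$; both ${\cal P}(M_1)$ and its submanifold ${\cal O}(\mathsf p)=\{u\mathsf p u^*:u\in U_M\}$ ($U_M$ the unitary group of $M$) carry the weak Riemannian metric $\langle a,b\rangle=\tau(b^*a)$ on tangent spaces. The geodesics of ${\cal P}(M_1)$ starting at $\mathsf p$ are the curves $e^{tw}\mathsf p e^{-tw}$ with $w\in M_1$, $w^*=-w$, $w=w\mathsf p+\mathsf p w$. The geodesics of (the Levi-Civita connection of) ${\cal O}(\mathsf p)$ starting at $\mathsf p$ are the curves $e^{tz}\mathsf p e^{-tz}$ with $z\in M$, $z^*=-z$, $E(z)=0$. *)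

theory Defs
  imports "HOL-Analysis.Analysis"
begin

section \<open>Complex Hilbert spaces and their bounded operators\<close>

class scaleC =
  fixes scaleC :: "complex \<Rightarrow> 'a \<Rightarrow> 'a"  (infixr \<open>*\<^sub>C\<close> 75)

text \<open>
  The inner product is linear in the first and conjugate-linear in the second variable, and its
  real part is the inner product of the underlying real Hilbert space. The space is nonzero, so
  that the identity operator has norm 1.
\<close>

class complex_hilbert = real_inner + complete_space + scaleC +
  fixes cinner :: "'a \<Rightarrow> 'a \<Rightarrow> complex"
  assumes scaleC_add_right: "c *\<^sub>C (x + y) = c *\<^sub>C x + c *\<^sub>C y"
    and scaleC_add_left: "(c + d) *\<^sub>C x = c *\<^sub>C x + d *\<^sub>C x"
    and scaleC_scaleC: "c *\<^sub>C d *\<^sub>C x = (c * d) *\<^sub>C x"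
    and scaleC_of_real: "complex_of_real r *\<^sub>C x = r *\<^sub>R x"
    and cinner_commute: "cinner x y = cnj (cinner y x)"
    and cinner_add_left: "cinner (x + y) z = cinner x z + cinner y z"
    and cinner_scaleC_left: "cinner (c *\<^sub>C x) y = c * cinner x y"
    and Re_cinner: "Re (cinner x y) = inner x y"
    and ex_nonzero: "\<exists>x. x \<noteq> 0"
begin

subclass banach ..

end

lemma norm_scaleC: "norm (c *\<^sub>C (x :: 'a :: complex_hilbert)) = cmod c * norm x"
proof -
  have "cinner (c *\<^sub>C x) (c *\<^sub>C x) = (c * cnj c) * cinner x x"
    by (metis cinner_commute cinner_scaleC_left complex_cnj_mult mult.assoc mult.left_commute)
  then have "inner (c *\<^sub>C x) (c *\<^sub>C x) = (cmod c)\<^sup>2 * inner x x"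
    by (metis Re_complex_of_real Re_cinner complex_norm_square of_real_mult scaleR_complex.sel(1)
        scaleR_conv_of_real real_scaleR_def)
  then show ?thesis
    by (simp add: norm_eq_sqrt_inner real_sqrt_mult)
qed

lemma bounded_linear_scaleC: "bounded_linear (\<lambda>x. c *\<^sub>C (x :: 'a :: complex_hilbert))"
proof
  fix x y :: 'a and r :: real
  show "c *\<^sub>C (x + y) = c *\<^sub>C x + c *\<^sub>C y"
    by (rule scaleC_add_right)
  show "c *\<^sub>C r *\<^sub>R x = r *\<^sub>R c *\<^sub>C x"
    by (metis mult.commute scaleC_of_real scaleC_scaleC)
  show "\<exists>K. \<forall>x::'a. norm (c *\<^sub>C x) \<le> norm x * K"
    by (metis norm_scaleC mult.commute order_refl)
qed

typedef (overloaded) ('a :: complex_hilbert) bop =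
  "{f :: 'a \<Rightarrow>\<^sub>L 'a. \<forall>c x. blinfun_apply f (c *\<^sub>C x) = c *\<^sub>C blinfun_apply f x}"
  morphisms blinfun_of_bop Bop
  by (rule exI[of _ id_blinfun]) simp

setup_lifting type_definition_bop

lift_definition bop_apply :: "'a :: complex_hilbert bop \<Rightarrow> 'a \<Rightarrow> 'a"  (infixr \<open>\<cdot>\<close> 80)
  is blinfun_apply .

instantiation bop :: (complex_hilbert) scaleC
begin

lift_definition scaleC_bop :: "complex \<Rightarrow> 'a bop \<Rightarrow> 'a bop"
  is "\<lambda>c f. Blinfun (\<lambda>x. c *\<^sub>C blinfun_apply f x)"
  by (simp add: bounded_linear_Blinfun_apply scaleC_scaleC mult.commute
      bounded_linear_compose[OF bounded_linear_scaleC blinfun.bounded_linear_right])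

instance ..

end

instantiation bop :: (complex_hilbert) real_normed_algebra_1
begin

lift_definition zero_bop :: "'a bop" is 0
  by (simp add: bounded_linear.linear[OF bounded_linear_scaleC] linear_0)
lift_definition one_bop :: "'a bop" is id_blinfun
  by simp
lift_definition plus_bop :: "'a bop \<Rightarrow> 'a bop \<Rightarrow> 'a bop" is plus
  by (simp add: blinfun.add_left scaleC_add_right)
lift_definition uminus_bop :: "'a bop \<Rightarrow> 'a bop" is uminus
  by (simp add: blinfun.minus_left linear_neg[OF bounded_linear.linear[OF bounded_linear_scaleC]])
lift_definition minus_bop :: "'a bop \<Rightarrow> 'a bop \<Rightarrow> 'a bop" is minus
  by (simp add: blinfun.diff_left linear_diff[OF bounded_linear.linear[OF bounded_linear_scaleC]])
lift_definition scaleR_bop :: "real \<Rightarrow> 'a bop \<Rightarrow> 'a bop" is scaleR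
  by (simp add: blinfun.scaleR_left linear_cmul[OF bounded_linear.linear[OF bounded_linear_scaleC]])
lift_definition times_bop :: "'a bop \<Rightarrow> 'a bop \<Rightarrow> 'a bop" is blinfun_compose
  by simp
lift_definition norm_bop :: "'a bop \<Rightarrow> real" is norm .

definition "dist_bop (a :: 'a bop) b = norm (a - b)"
definition "sgn_bop (a :: 'a bop) = scaleR (inverse (norm a)) a"
definition [code del]:
  "(uniformity :: ('a bop \<times> 'a bop) filter) = (INF e\<in>{0 <..}. principal {(x, y). dist x y < e})"
definition "open_bop (S :: 'a bop set) =
  (\<forall>x\<in>S. \<forall>\<^sub>F (x', y) in uniformity. x' = x \<longrightarrow> y \<in> S)"

instance
proof
  fix a b c :: "'a bop" and r s :: real
  show "a + b + c = a + (b + c)" by transfer (rule add.assoc)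
  show "a + b = b + a" by transfer (rule add.commute)
  show "0 + a = a" by transfer simp
  show "- a + a = 0" by transfer simp
  show "a - b = a + - b" by transfer simp
  show "r *\<^sub>R (a + b) = r *\<^sub>R a + r *\<^sub>R b" by transfer (rule scaleR_add_right)
  show "(r + s) *\<^sub>R a = r *\<^sub>R a + s *\<^sub>R a" by transfer (rule scaleR_add_left)
  show "r *\<^sub>R s *\<^sub>R a = (r * s) *\<^sub>R a" by transfer simp
  show "1 *\<^sub>R a = a" by transfer simp
  show "a * b * c = a * (b * c)" by transfer (auto intro: blinfun_eqI)
  show "(a + b) * c = a * c + b * c" by transfer (auto intro!: blinfun_eqI simp: blinfun.add_left)
  show "a * (b + c) = a * b + a * c"
    by transfer (auto intro!: blinfun_eqI simp: blinfun.add_left blinfun.add_right)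
  show "r *\<^sub>R a * b = r *\<^sub>R (a * b)"
    by transfer (auto intro!: blinfun_eqI simp: blinfun.scaleR_left)
  show "a * r *\<^sub>R b = r *\<^sub>R (a * b)"
    by transfer (auto intro!: blinfun_eqI simp: blinfun.scaleR_left blinfun.scaleR_right)
  show "1 * a = a" "a * 1 = a" by (transfer, auto intro: blinfun_eqI)+
  obtain v :: 'a where v: "v \<noteq> 0" using ex_nonzero by blast
  show "(0 :: 'a bop) \<noteq> 1"
  proof transfer
    show "(0 :: 'a \<Rightarrow>\<^sub>L 'a) \<noteq> id_blinfun"
      using v by (metis blinfun_apply_id_blinfun id_blinfun.rep_eq zero_blinfun.rep_eq)
  qed
  show "dist a b = norm (a - b)" by (rule dist_bop_def)
  show "sgn a = inverse (norm a) *\<^sub>R a" by (simp add: sgn_bop_def)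
  show "(uniformity :: ('a bop \<times> 'a bop) filter) = (INF e\<in>{0 <..}. principal {(x, y). dist x y < e})"
    by (rule uniformity_bop_def)
  show "open S = (\<forall>x\<in>S. \<forall>\<^sub>F (x', y) in uniformity. x' = x \<longrightarrow> y \<in> S)" for S :: "'a bop set"
    by (rule open_bop_def)
  show "norm a = 0 \<longleftrightarrow> a = 0" by transfer simp
  show "norm (a + b) \<le> norm a + norm b" by transfer (rule norm_triangle_ineq)
  show "norm (r *\<^sub>R a) = \<bar>r\<bar> * norm a" by transfer simp
  show "norm (a * b) \<le> norm a * norm b" by transfer (rule norm_blinfun_compose)
  show "norm (1 :: 'a bop) = 1"
  proof transfer
    show "norm (id_blinfun :: 'a \<Rightarrow>\<^sub>L 'a) = 1"
    proof (rule norm_blinfun_eqI)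
      show "1 \<le> norm (blinfun_apply id_blinfun v) / norm v" using v by simp
    qed auto
  qed
qed

end

lemma dist_bop_eq: "dist a b = dist (blinfun_of_bop a) (blinfun_of_bop b)"
  by (simp add: dist_bop_def dist_norm norm_bop.rep_eq minus_bop.rep_eq)

instance bop :: (complex_hilbert) banach
proof
  fix X :: "nat \<Rightarrow> 'a bop"
  assume "Cauchy X"
  then have "Cauchy (\<lambda>n. blinfun_of_bop (X n))"
    by (simp add: Cauchy_def dist_bop_eq)
  then obtain f where f: "(\<lambda>n. blinfun_of_bop (X n)) \<longlonglongrightarrow> f"
    using Cauchy_convergent convergent_def by blast
  have "blinfun_apply f (c *\<^sub>C v) = c *\<^sub>C blinfun_apply f v" for c v
  proof (rule LIMSEQ_unique)
    show "(\<lambda>n. blinfun_apply (blinfun_of_bop (X n)) (c *\<^sub>C v)) \<longlonglongrightarrow> blinfun_apply f (c *\<^sub>C v)"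
      by (intro tendsto_intros f)
    have "(\<lambda>n. c *\<^sub>C blinfun_apply (blinfun_of_bop (X n)) v) \<longlonglongrightarrow> c *\<^sub>C blinfun_apply f v"
      by (intro bounded_linear.tendsto[OF bounded_linear_scaleC] tendsto_intros f)
    then show "(\<lambda>n. blinfun_apply (blinfun_of_bop (X n)) (c *\<^sub>C v)) \<longlonglongrightarrow> c *\<^sub>C blinfun_apply f v"
      using blinfun_of_bop[of "X _"] by simp
  qed
  then have "blinfun_of_bop (Bop f) = f"
    by (simp add: Bop_inverse)
  then have "X \<longlonglongrightarrow> Bop f"
    using f by (simp add: tendsto_iff dist_bop_eq)
  then show "convergent X"
    by (auto simp: convergent_def)
qed

definition adj :: "'a :: complex_hilbert bop \<Rightarrow> 'a bop" where
  "adj a = (THE b. \<forall>v w. cinner (a \<cdot> v) w = cinner v (b \<cdot> w))"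

definition positive_op :: "'a :: complex_hilbert bop \<Rightarrow> bool" where
  "positive_op a \<longleftrightarrow> (\<forall>v. Im (cinner (a \<cdot> v) v) = 0 \<and> Re (cinner (a \<cdot> v) v) \<ge> 0)"

definition projection :: "'a :: complex_hilbert bop \<Rightarrow> bool" where
  "projection q \<longleftrightarrow> adj q = q \<and> q * q = q"

definition partial_isometry :: "'a :: complex_hilbert bop \<Rightarrow> bool" where
  "partial_isometry u \<longleftrightarrow> projection (adj u * u)"

definition projection_onto :: "'a :: complex_hilbert set \<Rightarrow> 'a bop" where
  "projection_onto S = (THE q. projection q \<and> range (bop_apply q) = S)"

definition sqrt_op :: "'a :: complex_hilbert bop \<Rightarrow> 'a bop" where
  "sqrt_op a = (THE b. positive_op b \<and> b * b = a)"

definition abs_op :: "'a :: complex_hilbert bop \<Rightarrow> 'a bop" where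
  "abs_op a = sqrt_op (adj a * a)"

text \<open>\<open>u\<close> is the partial isometry in the polar decomposition of \<open>a\<close>; the kernel condition makes it
  unique.\<close>

definition polar_part :: "'a :: complex_hilbert bop \<Rightarrow> 'a bop \<Rightarrow> bool" where
  "polar_part a u \<longleftrightarrow>
     partial_isometry u \<and> a = u * abs_op a \<and> (\<forall>v. u \<cdot> v = 0 \<longleftrightarrow> a \<cdot> v = 0)"


section \<open>Von Neumann algebras and \<open>II\<^sub>1\<close> factors\<close>

definition commutant :: "'a :: complex_hilbert bop set \<Rightarrow> 'a bop set" where
  "commutant S = {b. \<forall>a\<in>S. a * b = b * a}"

definition von_neumann_algebra :: "'a :: complex_hilbert bop set \<Rightarrow> bool" where
  "von_neumann_algebra A \<longleftrightarrow> (\<forall>a\<in>A. adj a \<in> A) \<and> commutant (commutant A) = A"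

definition vN_generated :: "'a :: complex_hilbert bop set \<Rightarrow> 'a bop set" where
  "vN_generated S = \<Inter> {A. von_neumann_algebra A \<and> S \<subseteq> A}"

definition factor :: "'a :: complex_hilbert bop set \<Rightarrow> bool" where
  "factor A \<longleftrightarrow> von_neumann_algebra A \<and> A \<inter> commutant A = range (\<lambda>c. c *\<^sub>C 1)"

definition finite_vN :: "'a :: complex_hilbert bop set \<Rightarrow> bool" where
  "finite_vN A \<longleftrightarrow> (\<forall>v\<in>A. adj v * v = 1 \<longrightarrow> v * adj v = 1)"

definition abelian_projection :: "'a :: complex_hilbert bop set \<Rightarrow> 'a bop \<Rightarrow> bool" where
  "abelian_projection A q \<longleftrightarrow> q \<in> A \<and> projection q \<and>
     (\<forall>a\<in>A. \<forall>b\<in>A. (q * a * q) * (q * b * q) = (q * b * q) * (q * a * q))"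

definition II1_factor :: "'a :: complex_hilbert bop set \<Rightarrow> bool" where
  "II1_factor A \<longleftrightarrow> factor A \<and> finite_vN A \<and> (\<forall>q. abelian_projection A q \<longrightarrow> q = 0)"

definition normalized_trace :: "'a :: complex_hilbert bop set \<Rightarrow> ('a bop \<Rightarrow> complex) \<Rightarrow> bool" where
  "normalized_trace A t \<longleftrightarrow>
     (\<forall>a\<in>A. \<forall>b\<in>A. t (a + b) = t a + t b) \<and>
     (\<forall>c. \<forall>a\<in>A. t (c *\<^sub>C a) = c * t a) \<and>
     (\<forall>a\<in>A. positive_op a \<longrightarrow> Im (t a) = 0 \<and> Re (t a) \<ge> 0) \<and>
     (\<forall>a\<in>A. \<forall>b\<in>A. t (a * b) = t (b * a)) \<and>
     t 1 = 1"

definition the_trace :: "'a :: complex_hilbert bop set \<Rightarrow> 'a bop \<Rightarrow> complex" where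
  "the_trace A = (THE t. normalized_trace A t \<and> t \<in> extensional A)"

text \<open>
  The dimension (coupling constant) \<open>dim\<^sub>A H\<close> of the Hilbert space \<open>H\<close> on which the finite factor
  \<open>A\<close> acts, after Murray and von Neumann: \<open>\<infinity>\<close> if the commutant \<open>A'\<close> is infinite, and otherwise
  \<open>tr\<^sub>A [A'\<xi>] / tr\<^sub>A\<^sub>' [A\<xi>]\<close>, which does not depend on the nonzero vector \<open>\<xi>\<close>; \<open>[S]\<close> is the
  projection onto the closure of \<open>S\<close>.
\<close>

definition coupling_constant :: "'a :: complex_hilbert bop set \<Rightarrow> ereal" where
  "coupling_constant A =
     (if finite_vN (commutant A) then
        (let \<xi> = (SOME \<xi>. \<xi> \<noteq> 0);
             q = projection_onto (closure ((\<lambda>b. b \<cdot> \<xi>) ` commutant A));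
             q' = projection_onto (closure ((\<lambda>a. a \<cdot> \<xi>) ` A))
         in ereal (Re (the_trace A q) / Re (the_trace (commutant A) q')))
      else \<infinity>)"


section \<open>The Jones construction\<close>

text \<open>
  \<open>M\<close> acts on its standard space \<open>L\<^sup>2(M, \<tau>)\<close>: the Hilbert space \<open>'a\<close> is the completion of \<open>M\<close> in
  \<open>\<langle>a, b\<rangle> = \<tau> (b\<^sup>* a)\<close>, where \<open>a \<in> M\<close> corresponds to the vector \<open>a\<Omega>\<close> and \<open>M\<close> acts by left
  multiplication. By uniqueness of the GNS construction this determines \<open>(M, 'a, \<Omega>)\<close> up to
  unitary equivalence.
\<close>

definition standard_L2 ::
  "'a :: complex_hilbert bop set \<Rightarrow> ('a bop \<Rightarrow> complex) \<Rightarrow> 'a \<Rightarrow> bool" where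
  "standard_L2 M \<tau> \<Omega> \<longleftrightarrow>
     (\<forall>a\<in>M. \<forall>b\<in>M. cinner (a \<cdot> \<Omega>) (b \<cdot> \<Omega>) = \<tau> (adj b * a)) \<and>
     closure ((\<lambda>a. a \<cdot> \<Omega>) ` M) = UNIV"

text \<open>\<open>L\<^sup>2(N, \<tau>)\<close> is the closure of \<open>N\<Omega>\<close>.\<close>

definition jones_projection :: "'a :: complex_hilbert bop set \<Rightarrow> 'a \<Rightarrow> 'a bop" where
  "jones_projection N \<Omega> = projection_onto (closure ((\<lambda>a. a \<cdot> \<Omega>) ` N))"

text \<open>Jones' index \<open>[M : N] = dim\<^sub>N L\<^sup>2(M, \<tau>)\<close>, for \<open>N \<subseteq> M\<close> represented on \<open>'a = L\<^sup>2(M, \<tau>)\<close>;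
  \<open>M\<close> enters only through this representation.\<close>

definition jones_index :: "'a :: complex_hilbert bop set \<Rightarrow> ereal" where
  "jones_index N = coupling_constant N"

definition trace_preserving_expectation ::
  "'a :: complex_hilbert bop set \<Rightarrow> 'a bop set \<Rightarrow> ('a bop \<Rightarrow> complex) \<Rightarrow> ('a bop \<Rightarrow> 'a bop) \<Rightarrow> bool" where
  "trace_preserving_expectation M N \<tau> E \<longleftrightarrow>
     (\<forall>a\<in>M. E a \<in> N) \<and>
     (\<forall>a\<in>M. \<forall>b\<in>M. E (a + b) = E a + E b) \<and>
     (\<forall>c. \<forall>a\<in>M. E (c *\<^sub>C a) = c *\<^sub>C E a) \<and>
     (\<forall>a\<in>M. positive_op a \<longrightarrow> positive_op (E a)) \<and>
     (\<forall>n\<in>N. E n = n) \<and>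
     (\<forall>a\<in>M. \<forall>m\<in>N. \<forall>n\<in>N. E (m * a * n) = m * E a * n) \<and>
     (\<forall>a\<in>M. \<tau> (E a) = \<tau> a)"

definition expectation_kernel ::
  "'a :: complex_hilbert bop set \<Rightarrow> ('a bop \<Rightarrow> 'a bop) \<Rightarrow> 'a bop set" where
  "expectation_kernel M E = {a \<in> M. E a = 0}"

definition jones_extension :: "'a :: complex_hilbert bop set \<Rightarrow> 'a bop \<Rightarrow> 'a bop set" where
  "jones_extension M p = vN_generated (insert p M)"

text \<open>
  Geodesics starting at \<open>p\<close>: in the manifold of projections of a von Neumann algebra \<open>A\<close>, and in
  the orbit \<open>{u p u\<^sup>* | u \<in> M unitary}\<close> of the Jones projection, both with the Riemannian metric
  given by the trace.
  They are defined by the usual explicit description as orbits of one-parameter groups with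
  co-diagonal generator, respectively with generator orthogonal to \<open>N\<close>.
\<close>

definition conj_curve :: "'a :: complex_hilbert bop \<Rightarrow> 'a bop \<Rightarrow> real \<Rightarrow> 'a bop" where
  "conj_curve w p t = exp (t *\<^sub>R w) * p * exp (- (t *\<^sub>R w))"

definition geodesic_of_projections ::
  "'a :: complex_hilbert bop set \<Rightarrow> 'a bop \<Rightarrow> (real \<Rightarrow> 'a bop) \<Rightarrow> bool" where
  "geodesic_of_projections A p \<gamma> \<longleftrightarrow>
     (\<exists>w\<in>A. adj w = - w \<and> w = w * p + p * w \<and> \<gamma> = conj_curve w p)"

definition geodesic_of_orbit ::
  "'a :: complex_hilbert bop set \<Rightarrow> ('a bop \<Rightarrow> 'a bop) \<Rightarrow> 'a bop \<Rightarrow> (real \<Rightarrow> 'a bop) \<Rightarrow> bool" where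
  "geodesic_of_orbit M E p \<gamma> \<longleftrightarrow>
     (\<exists>z\<in>M. adj z = - z \<and> E z = 0 \<and> \<gamma> = conj_curve z p)"

end

theory Submission
  imports Defs
begin

text \<open>
  For \<open>m \<in> M\<close> one has \<open>p m p = E(m) p\<close>, and \<open>m p = 0\<close> forces \<open>m = 0\<close>. Write \<open>w = x p - p x\<^sup>*\<close>. If
  \<open>\<gamma>\<close> is also the curve with generator \<open>z\<close>, equality of the first derivatives at \<open>0\<close> gives
  \<open>z p = x p\<close>, so \<open>z = x\<close> is skew-adjoint, and equality of the second derivatives gives
  \<open>x\<^sup>2 p = p x\<^sup>2 p = E(x\<^sup>2) p\<close>, so \<open>x\<^sup>2 \<in> N\<close>. Conversely, if \<open>x\<close> is skew-adjoint and \<open>x\<^sup>2\<close>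
  commutes with \<open>p\<close>, then \<open>d = x - w = (1 - p) x (1 - p)\<close> satisfies \<open>w d = d w = 0\<close> and
  \<open>d p = p d = 0\<close>, so \<open>d\<close> does not contribute to \<open>e\<^sup>t\<^sup>x p e\<^sup>-\<^sup>t\<^sup>x\<close>. The explicit formula is Euler's
  \<open>e\<^sup>t\<^sup>x = cos (t\<bar>x\<bar>) + u sin (t\<bar>x\<bar>)\<close>, in which \<open>\<bar>x\<bar>\<close> commutes with \<open>u\<close> and \<open>p\<close>.
\<close>

section \<open>Riesz representation by minimization\<close>

text \<open>First-order condition at a minimum: for small \<open>t\<close> of sign opposite to
  \<open>b\<close> the linear term outweighs the quadratic one.\<close>

lemma nonneg_quadratic_imp_zero:
  fixes b c :: real
  assumes "\<And>t. 0 \<le> 2 * t * b + t\<^sup>2 * c"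
  shows "b = 0"
proof (rule ccontr)
  assume "b \<noteq> 0"
  \<comment> \<open>Adding 1 keeps \<open>d\<close> positive even for \<open>c = 0\<close>, so that
    \<open>t = - b / d\<close> can serve as the test value.\<close>
  define d where "d = \<bar>c\<bar> + 1"
  have d: "d > 0" "c \<le> d" by (auto simp: d_def)
  have "0 \<le> 2 * (- b / d) * b + (- b / d)\<^sup>2 * c" by (rule assms)
  also have "\<dots> \<le> 2 * (- b / d) * b + (- b / d)\<^sup>2 * d"
    using d by (intro add_left_mono mult_left_mono) auto
  also have "\<dots> = - (b\<^sup>2 / d)"
    using d by (simp add: field_simps power2_eq_square)
  also have "\<dots> < 0" using d \<open>b \<noteq> 0\<close> by simp
  finally show False by simp
qed

text \<open>
  The solution is the limit of \<open>h v\<close> along a minimizing sequence of \<open>\<parallel>h v\<parallel>\<^sup>2 - 2 g v\<close> on \<open>V\<close>.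
  With \<open>h\<close> the identity this contains both the Riesz representation theorem and the orthogonal
  projection onto a closed subspace.
\<close>

lemma riesz_variational:
  fixes h :: "'b :: real_vector \<Rightarrow> 'a :: {real_inner, complete_space}" and g :: "'b \<Rightarrow> real"
  assumes h: "linear h" and g: "linear g" and V: "subspace V"
    and bound: "\<And>v. v \<in> V \<Longrightarrow> g v \<le> C * norm (h v)"
  obtains y where "y \<in> closure (h ` V)" and "\<And>v. v \<in> V \<Longrightarrow> inner y (h v) = g v"
proof -
  define J where "J v = inner (h v) (h v) - 2 * g v" for v
  define m where "m = Inf (J ` V)"
  have "J v \<ge> - (C\<^sup>2)" if "v \<in> V" for v
  proof -
    have "0 \<le> (norm (h v) - C)\<^sup>2" by simp
    also have "\<dots> = (norm (h v))\<^sup>2 - 2 * (C * norm (h v)) + C\<^sup>2" by (simp add: power2_diff algebra_simps)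
    finally show ?thesis using bound[OF that] by (simp add: J_def power2_norm_eq_inner)
  qed
  then have bdd: "bdd_below (J ` V)" by (auto intro!: bdd_belowI)
  have ne: "J ` V \<noteq> {}" using subspace_0[OF V] by auto
  have m_le: "m \<le> J v" if "v \<in> V" for v
    unfolding m_def using that by (intro cInf_lower bdd) auto
  have "\<exists>v\<in>V. J v < m + inverse (real (Suc n))" for n
  proof -
    have "Inf (J ` V) < m + inverse (real (Suc n))" by (simp add: m_def)
    then show ?thesis using cInf_less_iff[OF ne bdd] by auto
  qed
  then obtain v where vV: "\<And>n. v n \<in> V" and vJ: "\<And>n. J (v n) < m + inverse (real (Suc n))"
    by metis
  \<comment> \<open>Parallelogram identity: the linear part of \<open>J\<close> cancels against the
    midpoint, so near-minimizers have nearby images under \<open>h\<close>.\<close>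
  have par: "(norm (h a - h b))\<^sup>2 = 2 * J a + 2 * J b - 4 * J ((1/2) *\<^sub>R (a + b))" for a b
    by (simp add: J_def power2_norm_eq_inner linear_add[OF h] linear_add[OF g] linear_cmul[OF h]
        linear_cmul[OF g] inner_simps inner_commute algebra_simps)
  have "Cauchy (\<lambda>n. h (v n))"
  proof (rule CauchyI)
    fix e :: real assume "0 < e"
    \<comment> \<open>By \<open>par\<close> the squared distance is at most twice the sum of two
      defects, each below \<open>inverse (real (Suc K))\<close>; hence the quarter.\<close>
    then obtain K where K: "inverse (real (Suc K)) < e\<^sup>2 / 4"
      using reals_Archimedean[of "e\<^sup>2 / 4"] by auto
    have "norm (h (v i) - h (v j)) < e" if "i \<ge> K" "j \<ge> K" for i j
    proof -
      have "m \<le> J ((1/2) *\<^sub>R (v i + v j))"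
        by (intro m_le subspace_scale subspace_add V vV)
      moreover have "inverse (real (Suc i)) \<le> inverse (real (Suc K))"
        "inverse (real (Suc j)) \<le> inverse (real (Suc K))"
        using that by (auto intro!: le_imp_inverse_le)
      ultimately have "(norm (h (v i) - h (v j)))\<^sup>2 < e\<^sup>2"
        using par[of "v i" "v j"] vJ[of i] vJ[of j] K by linarith
      then show ?thesis using \<open>0 < e\<close> power2_less_imp_less by fastforce
    qed
    then show "\<exists>K. \<forall>i\<ge>K. \<forall>j\<ge>K. norm (h (v i) - h (v j)) < e" by blast
  qed
  then obtain y where y: "(\<lambda>n. h (v n)) \<longlonglongrightarrow> y"
    using Cauchy_convergent convergent_def by blast
  have "y \<in> closure (h ` V)"
    unfolding closure_sequential using y vV by (intro exI[of _ "\<lambda>n. h (v n)"]) auto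
  moreover have "inner y (h w) = g w" if "w \<in> V" for w
  proof -
    have "0 \<le> 2 * t * (inner y (h w) - g w) + t\<^sup>2 * inner (h w) (h w)" for t
    proof (rule LIMSEQ_le)
      show "(\<lambda>n. - inverse (real (Suc n))) \<longlonglongrightarrow> 0"
        using tendsto_minus[OF LIMSEQ_inverse_real_of_nat] by simp
      show "(\<lambda>n. 2 * t * (inner (h (v n)) (h w) - g w) + t\<^sup>2 * inner (h w) (h w))
          \<longlonglongrightarrow> 2 * t * (inner y (h w) - g w) + t\<^sup>2 * inner (h w) (h w)"
        by (intro tendsto_intros y)
      have "- inverse (real (Suc n)) \<le> 2 * t * (inner (h (v n)) (h w) - g w) + t\<^sup>2 * inner (h w) (h w)" for n
      proof -
        \<comment> \<open>No perturbation in direction \<open>w\<close> falls below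
          \<open>m\<close>, while \<open>J (v n)\<close> exceeds \<open>m\<close> by less than a
          null sequence. In the limit a nonnegative quadratic in \<open>t\<close> remains, whose
          linear coefficient must vanish.\<close>
        have "m \<le> J (v n + t *\<^sub>R w)"
          by (intro m_le subspace_scale subspace_add V vV that)
        also have "\<dots> = J (v n) + 2 * t * (inner (h (v n)) (h w) - g w) + t\<^sup>2 * inner (h w) (h w)"
          by (simp add: J_def linear_add[OF h] linear_add[OF g] linear_cmul[OF h]
              linear_cmul[OF g] inner_simps inner_commute algebra_simps power2_eq_square)
        finally show ?thesis using vJ[of n] by linarith
      qed
      then show "\<exists>N. \<forall>n\<ge>N. - inverse (real (Suc n))
          \<le> 2 * t * (inner (h (v n)) (h w) - g w) + t\<^sup>2 * inner (h w) (h w)"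
        by blast
    qed
    then show ?thesis using nonneg_quadratic_imp_zero[of "inner y (h w) - g w"] by auto
  qed
  ultimately show thesis by (rule that)
qed

lemma inner_closure_eq_0:
  assumes "y \<in> closure S" and "\<And>s. s \<in> S \<Longrightarrow> inner v s = 0"
  shows "inner v y = 0"
proof -
  obtain s where s: "\<And>n. s n \<in> S" "s \<longlonglongrightarrow> y"
    using assms(1) by (auto simp: closure_sequential)
  then have "(\<lambda>n. inner v (s n)) \<longlonglongrightarrow> inner v y" by (intro tendsto_intros)
  then show ?thesis using assms(2) s(1) by (simp add: LIMSEQ_const_iff)
qed

lemma subspace_closure:
  fixes S :: "'a :: real_normed_vector set"
  assumes "subspace S"
  shows "subspace (closure S)"
  unfolding subspace_def
proof (intro conjI ballI allI)
  show "0 \<in> closure S" using assms closure_subset subspace_0 by blast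
next
  fix x y assume "x \<in> closure S" "y \<in> closure S"
  then obtain f g where f: "\<forall>n. f n \<in> S" "f \<longlonglongrightarrow> x" and g: "\<forall>n. g n \<in> S" "g \<longlonglongrightarrow> y"
    unfolding closure_sequential by blast
  then have "(\<lambda>n. f n + g n) \<longlonglongrightarrow> x + y" by (intro tendsto_intros)
  then show "x + y \<in> closure S"
    unfolding closure_sequential
    using f g subspace_add[OF assms] by (intro exI[of _ "\<lambda>n. f n + g n"]) auto
next
  fix c :: real and x assume "x \<in> closure S"
  then obtain f where f: "\<forall>n. f n \<in> S" "f \<longlonglongrightarrow> x" unfolding closure_sequential by blast
  then have "(\<lambda>n. c *\<^sub>R f n) \<longlonglongrightarrow> c *\<^sub>R x" by (intro tendsto_intros)
  then show "c *\<^sub>R x \<in> closure S"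
    unfolding closure_sequential
    using f subspace_scale[OF assms] by (intro exI[of _ "\<lambda>n. c *\<^sub>R f n"]) auto
qed

section \<open>Operator calculus\<close>

text \<open>The real inner product against \<open>\<i> *\<^sub>C w\<close> is the imaginary part.
  Most later arguments can therefore work with the real \<open>inner\<close>.\<close>

lemma cinner_eq_Complex:
  "cinner v w = Complex (inner v w) (inner v (\<i> *\<^sub>C (w :: 'a :: complex_hilbert)))"
proof -
  have "cinner v (\<i> *\<^sub>C w) = - \<i> * cinner v w"
    by (metis cinner_commute cinner_scaleC_left complex_cnj_i complex_cnj_mult)
  then have "inner v (\<i> *\<^sub>C w) = Im (cinner v w)"
    using Re_cinner[of v "\<i> *\<^sub>C w"] by simp
  then show ?thesis by (simp add: complex_eq_iff Re_cinner)
qed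

lemma inner_scaleC_left:
  fixes v w :: "'a :: complex_hilbert"
  shows "inner (c *\<^sub>C v) w = inner v (cnj c *\<^sub>C w)"
proof -
  have "cinner (c *\<^sub>C v) w = cinner v (cnj c *\<^sub>C w)"
    by (metis cinner_commute cinner_scaleC_left complex_cnj_cnj complex_cnj_mult)
  then show ?thesis by (metis Re_cinner)
qed

lemma scaleC_one [simp]: "1 *\<^sub>C (v :: 'a :: complex_hilbert) = v"
  using scaleC_of_real[of 1 v] by simp

lemma scaleC_minus_one [simp]: "- 1 *\<^sub>C (v :: 'a :: complex_hilbert) = - v"
  using scaleC_of_real[of "- 1" v] by simp

lemma bop_eqI: "(\<And>v. a \<cdot> v = b \<cdot> v) \<Longrightarrow> a = b"
  by transfer (rule blinfun_eqI)

lemma bounded_linear_bop_apply: "bounded_linear (bop_apply a)"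
  by transfer (rule blinfun.bounded_linear_right)

lemmas linear_bop_apply = bounded_linear.linear[OF bounded_linear_bop_apply]

lemma bop_apply_simps [simp]:
  "(a * b) \<cdot> v = a \<cdot> b \<cdot> v" "(a + b) \<cdot> v = a \<cdot> v + b \<cdot> v" "(a - b) \<cdot> v = a \<cdot> v - b \<cdot> v"
  "(- a) \<cdot> v = - (a \<cdot> v)" "0 \<cdot> v = 0" "1 \<cdot> v = v" "(r *\<^sub>R a) \<cdot> v = r *\<^sub>R (a \<cdot> v)"
  by (transfer, simp add: blinfun.add_left blinfun.diff_left blinfun.minus_left blinfun.scaleR_left)+

lemma scaleC_bop_apply [simp]: "(c *\<^sub>C a) \<cdot> v = c *\<^sub>C a \<cdot> v"
  by transfer (simp add: bounded_linear_Blinfun_apply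
      bounded_linear_compose[OF bounded_linear_scaleC blinfun.bounded_linear_right])

lemma bop_apply_scaleC [simp]: "a \<cdot> (c *\<^sub>C v) = c *\<^sub>C a \<cdot> v"
  by transfer simp

lemma bop_apply_linear [simp]:
  "a \<cdot> (v + w) = a \<cdot> v + a \<cdot> w" "a \<cdot> (v - w) = a \<cdot> v - a \<cdot> w" "a \<cdot> (- v) = - (a \<cdot> v)"
  "a \<cdot> 0 = 0" "a \<cdot> (r *\<^sub>R v) = r *\<^sub>R (a \<cdot> v)"
  using linear_add[OF linear_bop_apply] linear_diff[OF linear_bop_apply]
    linear_neg[OF linear_bop_apply] linear_0[OF linear_bop_apply] linear_cmul[OF linear_bop_apply]
  by metis+

lemma scaleC_bop_minus_one [simp]: "- 1 *\<^sub>C (a :: 'a :: complex_hilbert bop) = - a"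
  by (rule bop_eqI) simp

lemma scaleR_eq_scaleC_bop: "r *\<^sub>R (a :: 'a :: complex_hilbert bop) = complex_of_real r *\<^sub>C a"
  by (rule bop_eqI) (simp add: scaleC_of_real)

lemma norm_bop_apply: "norm (a \<cdot> v) \<le> norm a * norm v"
  by transfer (rule norm_blinfun)

lemma norm_bop_leI: "0 \<le> r \<Longrightarrow> (\<And>v. norm (a \<cdot> v) \<le> r * norm v) \<Longrightarrow> norm a \<le> r"
  by transfer (rule norm_blinfun_bound)

lemma ex_bop:
  fixes f :: "'a :: complex_hilbert \<Rightarrow> 'a"
  assumes "\<And>v w. f (v + w) = f v + f w" "\<And>c v. f (c *\<^sub>C v) = c *\<^sub>C f v"
    and "\<And>v. norm (f v) \<le> norm v * C"
  shows "\<exists>b. \<forall>v. b \<cdot> v = f v"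
proof -
  have "bounded_linear f"
    using assms by (intro bounded_linear_intro[of _ C]) (auto simp flip: scaleC_of_real)
  then have "Blinfun f \<in> {f. \<forall>c x. blinfun_apply f (c *\<^sub>C x) = c *\<^sub>C blinfun_apply f x}"
    by (simp add: bounded_linear_Blinfun_apply assms(2))
  then have "Bop (Blinfun f) \<cdot> v = f v" for v
    using \<open>bounded_linear f\<close> by (simp add: bop_apply.rep_eq Bop_inverse bounded_linear_Blinfun_apply)
  then show ?thesis by blast
qed

lemma scaleC_closure:
  fixes S :: "'a :: complex_hilbert set"
  assumes "\<And>v. v \<in> S \<Longrightarrow> c *\<^sub>C v \<in> S" and "v \<in> closure S"
  shows "c *\<^sub>C v \<in> closure S"
proof -
  have "(\<lambda>v. c *\<^sub>C v) ` closure S \<subseteq> closure ((\<lambda>v. c *\<^sub>C v) ` S)"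
    by (rule closure_bounded_linear_image_subset[OF bounded_linear_scaleC])
  also have "\<dots> \<subseteq> closure S" using assms(1) by (intro closure_mono) auto
  finally show ?thesis using assms(2) by auto
qed

text \<open>
  The choices \<open>h = 1\<close>, \<open>h = x = 1\<close> and \<open>h = \<bar>x\<bar>\<close> produce adjoints, orthogonal projections
  and polar decompositions.
\<close>

lemma ex_weak_factor:
  fixes h x :: "'a :: complex_hilbert bop"
  assumes V: "0 \<in> V" "\<And>v w. v \<in> V \<Longrightarrow> w \<in> V \<Longrightarrow> v + w \<in> V" "\<And>c v. v \<in> V \<Longrightarrow> c *\<^sub>C v \<in> V"
    and C: "0 \<le> C" "\<And>v. v \<in> V \<Longrightarrow> norm (x \<cdot> v) \<le> C * norm (h \<cdot> v)"
  shows "\<exists>b. \<forall>w. b \<cdot> w \<in> closure (bop_apply h ` V) \<and> (\<forall>v\<in>V. inner (b \<cdot> w) (h \<cdot> v) = inner w (x \<cdot> v))"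
proof -
  let ?S = "closure (bop_apply h ` V)"
  have sub: "subspace V"
    using V by (auto simp: subspace_def simp flip: scaleC_of_real)
  have subS: "subspace ?S"
    by (intro subspace_closure linear_subspace_image linear_bop_apply sub)
  have ex: "\<exists>y\<in>?S. \<forall>v\<in>V. inner y (h \<cdot> v) = inner w (x \<cdot> v)" for w
  proof -
    have "inner w (x \<cdot> v) \<le> norm w * C * norm (h \<cdot> v)" if "v \<in> V" for v
    proof -
      have "inner w (x \<cdot> v) \<le> norm w * norm (x \<cdot> v)" by (rule norm_cauchy_schwarz)
      also have "\<dots> \<le> norm w * (C * norm (h \<cdot> v))" by (intro mult_left_mono C that) simp
      finally show ?thesis by (simp add: mult.assoc)
    qed
    moreover have "linear (\<lambda>v. inner w (x \<cdot> v))"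
      by (auto intro!: linearI simp: inner_add_right)
    ultimately obtain y where "y \<in> ?S" "\<And>v. v \<in> V \<Longrightarrow> inner y (h \<cdot> v) = inner w (x \<cdot> v)"
      using riesz_variational[OF linear_bop_apply _ sub] by blast
    then show ?thesis by blast
  qed
  define f where "f w = (SOME y. y \<in> ?S \<and> (\<forall>v\<in>V. inner y (h \<cdot> v) = inner w (x \<cdot> v)))" for w
  have "f w \<in> ?S \<and> (\<forall>v\<in>V. inner (f w) (h \<cdot> v) = inner w (x \<cdot> v))" for w
    unfolding f_def by (rule someI_ex) (use ex[of w] in blast)
  then have fS: "\<And>w. f w \<in> ?S" and f: "\<And>w v. v \<in> V \<Longrightarrow> inner (f w) (h \<cdot> v) = inner w (x \<cdot> v)"
    by blast+
  \<comment> \<open>A vector of \<open>?S\<close> is determined by its inner products with a dense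
    part of \<open>?S\<close>; this makes the pointwise choice \<open>f\<close> linear.\<close>
  have uniq: "y = z" if "y \<in> ?S" "z \<in> ?S" "\<And>v. v \<in> V \<Longrightarrow> inner y (h \<cdot> v) = inner z (h \<cdot> v)" for y z
  proof -
    have "inner (y - z) (y - z) = 0"
    proof (rule inner_closure_eq_0)
      show "y - z \<in> ?S" by (intro subspace_diff subS that(1,2))
      show "inner (y - z) s = 0" if "s \<in> bop_apply h ` V" for s
        using that \<open>\<And>v. v \<in> V \<Longrightarrow> inner y (h \<cdot> v) = inner z (h \<cdot> v)\<close> by (auto simp: inner_diff_left)
    qed
    then show ?thesis by simp
  qed
  have Ssc: "c *\<^sub>C y \<in> ?S" if "y \<in> ?S" for c y
    using that V(3) by (intro scaleC_closure) (auto simp flip: bop_apply_scaleC)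
  have "\<exists>b. \<forall>v. b \<cdot> v = f v"
  proof (rule ex_bop)
    show "f (v + w) = f v + f w" for v w
    proof (rule uniq)
      show "f v + f w \<in> ?S" by (intro subspace_add subS fS)
    qed (simp_all add: fS f inner_add_left)
    show "f (c *\<^sub>C v) = c *\<^sub>C f v" for c v
    proof (rule uniq)
      show "inner (f (c *\<^sub>C v)) (h \<cdot> u) = inner (c *\<^sub>C f v) (h \<cdot> u)" if "u \<in> V" for u
      proof -
        have "inner (c *\<^sub>C f v) (h \<cdot> u) = inner (f v) (h \<cdot> (cnj c *\<^sub>C u))"
          by (simp add: inner_scaleC_left)
        also have "\<dots> = inner v (x \<cdot> (cnj c *\<^sub>C u))"
          by (rule f) (rule V(3)[OF that])
        also have "\<dots> = inner (c *\<^sub>C v) (x \<cdot> u)"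
          by (simp add: inner_scaleC_left)
        finally show ?thesis using f[OF that] by simp
      qed
    qed (intro fS Ssc)+
    show "norm (f w) \<le> norm w * C" for w
    proof -
      \<comment> \<open>Testing \<open>f w\<close> against approximants of \<open>f w\<close> itself
        turns the weak identity into a norm bound.\<close>
      obtain s where s: "\<And>n. s n \<in> bop_apply h ` V" "s \<longlonglongrightarrow> f w"
        using fS[of w] by (auto simp: closure_sequential)
      have "inner (f w) (f w) \<le> norm w * (C * norm (f w))"
      proof (rule LIMSEQ_le)
        show "(\<lambda>n. inner (f w) (s n)) \<longlonglongrightarrow> inner (f w) (f w)"
          "(\<lambda>n. norm w * (C * norm (s n))) \<longlonglongrightarrow> norm w * (C * norm (f w))"
          by (intro tendsto_intros s)+
        have "inner (f w) (s n) \<le> norm w * (C * norm (s n))" for n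
        proof -
          obtain v where v: "v \<in> V" "s n = h \<cdot> v" using s(1) by blast
          have "inner w (x \<cdot> v) \<le> norm w * norm (x \<cdot> v)" by (rule norm_cauchy_schwarz)
          also have "\<dots> \<le> norm w * (C * norm (h \<cdot> v))" by (intro mult_left_mono C v) simp
          finally show ?thesis by (simp add: v f)
        qed
        then show "\<exists>N. \<forall>n\<ge>N. inner (f w) (s n) \<le> norm w * (C * norm (s n))" by blast
      qed
      then have "norm (f w) * norm (f w) \<le> norm w * C * norm (f w)"
        by (simp add: power2_norm_eq_inner[symmetric] power2_eq_square mult.assoc)
      then show ?thesis
        using C(1) by (cases "f w = 0") auto
    qed
  qed
  then obtain b where "\<And>v. b \<cdot> v = f v" by blast
  then show ?thesis using fS f by (intro exI[of _ b]) auto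
qed

section \<open>Adjoints of bounded operators\<close>

lemma ex_adjoint: "\<exists>b. \<forall>v w. inner (a \<cdot> v) w = inner v (b \<cdot> w)"
proof -
  have "\<exists>b. \<forall>w. b \<cdot> w \<in> closure (bop_apply 1 ` UNIV) \<and>
      (\<forall>v\<in>UNIV. inner (b \<cdot> w) (1 \<cdot> v) = inner w (a \<cdot> v))"
    by (rule ex_weak_factor[where C = "norm a"]) (auto simp: norm_bop_apply)
  then show ?thesis by (metis UNIV_I bop_apply_simps(6) inner_commute)
qed

text \<open>Since \<open>b\<close> commutes with multiplication by \<open>\<i>\<close>, the real
  identity applied to \<open>\<i> *\<^sub>C w\<close> supplies the imaginary part of the complex
  one.\<close>

lemma cinner_adjoint_iff:
  "(\<forall>v w. cinner (a \<cdot> v) w = cinner v (b \<cdot> w)) \<longleftrightarrow> (\<forall>v w. inner (a \<cdot> v) w = inner v (b \<cdot> w))"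
  by (metis Re_cinner bop_apply_scaleC cinner_eq_Complex)

lemma inner_adj: "inner (a \<cdot> v) w = inner v (adj a \<cdot> w)"
  and adj_eqI: "(\<And>v w. inner (a \<cdot> v) w = inner v (b \<cdot> w)) \<Longrightarrow> adj a = b"
proof -
  have uniq: "b = c" if "\<forall>v w. inner (a \<cdot> v) w = inner v (b \<cdot> w)"
    "\<forall>v w. inner (a \<cdot> v) w = inner v (c \<cdot> w)" for b c
  proof (rule bop_eqI)
    fix w
    have "inner v (b \<cdot> w) = inner v (c \<cdot> w)" for v
      using that(1)[rule_format, of v w, symmetric] that(2)[rule_format, of v w] by (rule trans)
    then show "b \<cdot> w = c \<cdot> w" using vector_eq_ldot by blast
  qed
  obtain b where b: "\<forall>v w. inner (a \<cdot> v) w = inner v (b \<cdot> w)"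
    using ex_adjoint by blast
  have adj: "adj a = c" if "\<forall>v w. inner (a \<cdot> v) w = inner v (c \<cdot> w)" for c
    unfolding adj_def cinner_adjoint_iff by (rule the_equality) (rule that, rule uniq[OF _ that])
  show "inner (a \<cdot> v) w = inner v (adj a \<cdot> w)"
    using b unfolding adj[OF b] by simp
  show "(\<And>v w. inner (a \<cdot> v) w = inner v (b \<cdot> w)) \<Longrightarrow> adj a = b" for b
    by (rule adj) simp
qed

lemma inner_adj_left: "inner (adj a \<cdot> v) w = inner v (a \<cdot> w)"
  by (metis inner_adj inner_commute)

lemma cinner_adj: "cinner (a \<cdot> v) w = cinner v (adj a \<cdot> w)"
  using cinner_adjoint_iff[of a "adj a"] inner_adj by blast

lemma adj_adj [simp]: "adj (adj a) = a"
  by (rule adj_eqI) (rule inner_adj_left)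

lemma adj_simps [simp]:
  "adj (a * b) = adj b * adj a" "adj (a + b) = adj a + adj b"
  "adj (a - b) = adj a - adj b" "adj (- a) = - adj a" "adj 1 = 1" "adj 0 = 0"
  "adj (r *\<^sub>R a) = r *\<^sub>R adj a" "adj (c *\<^sub>C a) = cnj c *\<^sub>C adj a"
  by (rule adj_eqI; simp add: inner_adj inner_simps inner_scaleC_left)+

lemma adj_mult_self_eq_0:
  assumes "adj a * a = 0"
  shows "a = 0"
proof (rule bop_eqI)
  fix v
  have "inner (a \<cdot> v) (a \<cdot> v) = inner v ((adj a * a) \<cdot> v)" by (simp add: inner_adj)
  then show "a \<cdot> v = 0 \<cdot> v" by (simp add: assms)
qed

lemma norm_adj_le: "norm (adj a) \<le> norm a"
proof (rule norm_bop_leI)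
  fix v
  have "norm (adj a \<cdot> v) * norm (adj a \<cdot> v) = inner (a \<cdot> adj a \<cdot> v) v"
    by (simp add: inner_adj power2_norm_eq_inner[symmetric] power2_eq_square)
  also have "\<dots> \<le> norm (a \<cdot> adj a \<cdot> v) * norm v"
    by (rule norm_cauchy_schwarz)
  also have "\<dots> \<le> norm a * norm (adj a \<cdot> v) * norm v"
    by (intro mult_right_mono norm_bop_apply) simp
  finally show "norm (adj a \<cdot> v) \<le> norm a * norm v"
    by (cases "adj a \<cdot> v = 0") (auto simp: mult.assoc mult.left_commute)
qed simp

section \<open>Positive operators, square roots and the modulus\<close>

text \<open>Over the complex numbers a real-valued quadratic form comes from a selfadjoint operator:
  polarization makes the imaginary part antisymmetric, and multiplying an argument by
  \<open>\<i>\<close> carries this over to the real part.\<close>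

lemma positive_op_iff: "positive_op a \<longleftrightarrow> adj a = a \<and> (\<forall>v. 0 \<le> inner (a \<cdot> v) v)"
proof
  assume pos: "positive_op a"
  then have i0: "inner (a \<cdot> v) (\<i> *\<^sub>C v) = 0" for v
    unfolding positive_op_def by (simp only: cinner_eq_Complex complex.sel)
  have anti: "inner (a \<cdot> v) (\<i> *\<^sub>C w) = - inner (a \<cdot> w) (\<i> *\<^sub>C v)" for v w
    using i0[of "v + w"] i0[of v] i0[of w] by (simp add: scaleC_add_right inner_simps)
  have ii: "\<i> *\<^sub>C \<i> *\<^sub>C v = - v" for v :: 'a
    by (simp add: scaleC_scaleC)
  have "inner (a \<cdot> v) w = inner v (a \<cdot> w)" for v w
  proof -
    have "inner (a \<cdot> v) w = - inner (a \<cdot> v) (\<i> *\<^sub>C \<i> *\<^sub>C w)" by (simp add: ii)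
    also have "\<dots> = inner (\<i> *\<^sub>C a \<cdot> w) (\<i> *\<^sub>C v)" by (simp add: anti[of v])
    also have "\<dots> = inner (a \<cdot> w) v"
      by (simp add: inner_scaleC_left scaleC_scaleC)
    finally show ?thesis by (simp add: inner_commute)
  qed
  then show "adj a = a \<and> (\<forall>v. 0 \<le> inner (a \<cdot> v) v)"
    using pos by (auto intro: adj_eqI simp: positive_op_def Re_cinner)
next
  assume a: "adj a = a \<and> (\<forall>v. 0 \<le> inner (a \<cdot> v) v)"
  have "Im (cinner (a \<cdot> v) v) = 0" for v
  proof -
    have "cinner (a \<cdot> v) v = cinner v (a \<cdot> v)" using cinner_adj[of a v v] a by simp
    also have "\<dots> = cnj (cinner (a \<cdot> v) v)" by (rule cinner_commute)
    finally have "Im (cinner (a \<cdot> v) v) = - Im (cinner (a \<cdot> v) v)" using cnj.sel(2) by metis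
    then show ?thesis by simp
  qed
  then show "positive_op a" using a by (simp add: positive_op_def Re_cinner)
qed

text \<open>Along \<open>v + t *\<^sub>R a \<cdot> v\<close> the form is nonnegative and vanishes at
  \<open>t = 0\<close>, where its derivative is twice the squared norm of
  \<open>a \<cdot> v\<close>.\<close>

lemma positive_op_kernel:
  assumes "positive_op a" and "inner (a \<cdot> v) v = 0"
  shows "a \<cdot> v = 0"
proof -
  have a: "adj a = a" "\<And>v. 0 \<le> inner (a \<cdot> v) v"
    using assms(1) by (auto simp: positive_op_iff)
  have "0 \<le> 2 * t * inner (a \<cdot> v) (a \<cdot> v) + t\<^sup>2 * inner (a \<cdot> a \<cdot> v) (a \<cdot> v)" for t
  proof -
    have "inner (a \<cdot> a \<cdot> v) v = inner (a \<cdot> v) (a \<cdot> v)"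
      by (simp add: inner_adj[of a "a \<cdot> v"] a)
    then show ?thesis
      using a(2)[of "v + t *\<^sub>R a \<cdot> v"] assms(2)
      by (simp add: inner_simps power2_eq_square algebra_simps)
  qed
  then show ?thesis using nonneg_quadratic_imp_zero inner_eq_zero_iff by blast
qed

text \<open>From \<open>(a + b) * (a - b) = 0\<close>, the forms of \<open>a\<close> and
  \<open>b\<close> at \<open>w = (a - b) \<cdot> v\<close> add up to 0, so both operators kill
  \<open>w\<close>. As \<open>a - b\<close> is selfadjoint, the squared norm of \<open>w\<close> is
  the inner product of \<open>v\<close> with \<open>(a - b) \<cdot> w = 0\<close>.\<close>

lemma commuting_positive_sqrt_unique:
  assumes "positive_op a" "positive_op b" "a * a = b * b" "a * b = b * a"
  shows "a = b"
proof (rule bop_eqI)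
  fix v
  define w where "w = (a - b) \<cdot> v"
  have "(a + b) * (a - b) = 0" using assms(3,4) by (simp add: algebra_simps)
  then have "(a + b) \<cdot> w = 0" by (metis bop_apply_simps(1,5) w_def)
  then have "inner (a \<cdot> w) w + inner (b \<cdot> w) w = 0"
    by (metis bop_apply_simps(2) inner_add_left inner_zero_left)
  moreover have "inner (a \<cdot> w) w \<ge> 0" "inner (b \<cdot> w) w \<ge> 0"
    using assms(1,2) by (auto simp: positive_op_iff)
  ultimately have "a \<cdot> w = 0" "b \<cdot> w = 0"
    using assms(1,2) positive_op_kernel[of a w] positive_op_kernel[of b w] by auto
  then have "(a - b) \<cdot> w = 0" by simp
  moreover have "inner w w = inner v ((a - b) \<cdot> w)"
  proof -
    have "adj (a - b) = a - b" using assms(1,2) by (simp add: positive_op_iff)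
    then show ?thesis using inner_adj[of "a - b" v w] by (simp add: w_def)
  qed
  ultimately show "a \<cdot> v = b \<cdot> v" by (simp add: w_def)
qed

lemma bounded_linear_bop_eval: "bounded_linear (\<lambda>a. a \<cdot> v)"
  by (rule bounded_linear_intro[of _ "norm v"]) (auto simp: norm_bop_apply)

text \<open>
  With \<open>b = 1 - x\<^sup>* x\<close>, the square root is \<open>1 - y\<close> for the fixed point \<open>y = (b + y\<^sup>2) / 2\<close>. The
  iteration started at \<open>0\<close> converges in norm, since its increments are dominated by those of the
  scalar iteration with \<open>b = 1\<close>, which increases and is bounded by \<open>1\<close>.
\<close>

lemma ex_sqrt_contraction:
  fixes x :: "'a :: complex_hilbert bop"
  assumes "norm x \<le> 1"
  shows "\<exists>s. positive_op s \<and> s * s = adj x * x \<and>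
    (\<forall>z. z * (adj x * x) = (adj x * x) * z \<longrightarrow> z * s = s * z)"
proof -
  define b where "b = 1 - adj x * x"
  \<comment> \<open>Expanding the square gives \<open>- 2\<close> times the squared norm of
    \<open>x \<cdot> v\<close>, which absorbs the last term because \<open>adj x\<close> is a
    contraction as well.\<close>
  have nb: "norm b \<le> 1"
  proof (rule norm_bop_leI)
    fix v
    have "norm (adj x \<cdot> x \<cdot> v) \<le> norm (adj x) * norm (x \<cdot> v)" by (rule norm_bop_apply)
    also have "\<dots> \<le> 1 * norm (x \<cdot> v)"
      using norm_adj_le[of x] assms by (intro mult_right_mono) auto
    finally have "(norm (adj x \<cdot> x \<cdot> v))\<^sup>2 \<le> (norm (x \<cdot> v))\<^sup>2" by (simp add: power_mono)
    moreover have "(norm (b \<cdot> v))\<^sup>2 = (norm v)\<^sup>2 - 2 * (norm (x \<cdot> v))\<^sup>2 + (norm (adj x \<cdot> x \<cdot> v))\<^sup>2"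
      by (simp add: b_def power2_norm_eq_inner inner_simps inner_adj_left inner_adj)
    ultimately have "(norm (b \<cdot> v))\<^sup>2 \<le> (norm v)\<^sup>2"
      by (smt (verit) zero_le_power2)
    then show "norm (b \<cdot> v) \<le> 1 * norm v" by (simp add: power2_le_iff_abs_le)
  qed simp
  define y where "y = rec_nat 0 (\<lambda>_ y. (1/2) *\<^sub>R (b + y * y))"
  define r where "r = rec_nat (0::real) (\<lambda>_ r. (1 + r * r) / 2)"
  have y: "y 0 = 0" "\<And>n. y (Suc n) = (1/2) *\<^sub>R (b + y n * y n)"
    and r: "r 0 = 0" "\<And>n. r (Suc n) = (1 + r n * r n) / 2"
    by (auto simp: y_def r_def)
  have r01: "0 \<le> r n \<and> r n \<le> 1" for n
  proof (induction n)
    case (Suc n)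
    then have "r n * r n \<le> 1 * 1" by (intro mult_mono) auto
    with Suc show ?case by (simp add: r)
  qed (simp add: r)
  have rmono: "r n \<le> r (Suc n)" for n
  proof -
    have "r (Suc n) - r n = (1 - r n)\<^sup>2 / 2" by (simp add: r power2_eq_square field_simps)
    also have "\<dots> \<ge> 0" by simp
    finally show ?thesis by simp
  qed
  have yr: "norm (y n) \<le> r n" for n
  proof (induction n)
    case (Suc n)
    have "norm (y (Suc n)) \<le> (1/2) * (norm b + norm (y n) * norm (y n))"
      using norm_triangle_ineq[of b "y n * y n"] norm_mult_ineq[of "y n" "y n"] by (simp add: y)
    also have "\<dots> \<le> (1/2) * (1 + r n * r n)"
      using nb Suc r01[of n] by (intro mult_left_mono add_mono mult_mono) auto
    finally show ?case by (simp add: r)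
  qed (simp add: y r)
  \<comment> \<open>Each \<open>y n\<close> is a polynomial in \<open>b\<close>. Commuting iterates
    allow differences of squares to be factored, and the limit inherits commutation with everything
    commuting with \<open>b\<close>.\<close>
  have ycomm: "z * y n = y n * z" if "z * b = b * z" for z n
  proof (induction n)
    case (Suc n)
    have "z * (y n * y n) = (y n * y n) * z" using Suc by (metis mult.assoc)
    with that show ?case by (simp add: y algebra_simps)
  qed (simp add: y)
  have yy: "y m * y n = y n * y m" for m n
    using ycomm[of "y m" n] ycomm[of b m] by simp
  have step: "norm (y (Suc n) - y n) \<le> r (Suc n) - r n" for n
  proof (induction n)
    case 0
    show ?case using nb by (simp add: y r)
  next
    case (Suc n)
    have "y (Suc (Suc n)) - y (Suc n) = (1/2) *\<^sub>R (y (Suc n) * y (Suc n) - y n * y n)"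
      by (simp only: y(2)[of "Suc n"] y(2)[of n]) (simp add: algebra_simps)
    also have "\<dots> = (1/2) *\<^sub>R ((y (Suc n) - y n) * (y (Suc n) + y n))"
      using yy[of "Suc n" n] by (simp add: algebra_simps)
    finally have "norm (y (Suc (Suc n)) - y (Suc n)) \<le> (1/2) * (norm (y (Suc n) - y n) * norm (y (Suc n) + y n))"
      by (simp add: norm_mult_ineq)
    also have "\<dots> \<le> (1/2) * ((r (Suc n) - r n) * (r (Suc n) + r n))"
      using Suc norm_triangle_ineq[of "y (Suc n)" "y n"] yr[of n] yr[of "Suc n"] rmono[of n]
      by (intro mult_left_mono mult_mono) auto
    also have "\<dots> = r (Suc (Suc n)) - r (Suc n)"
      by (simp only: r(2)[of "Suc n"]) (simp add: r(2)[of n] field_simps)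
    finally show ?case .
  qed
  have "summable (\<lambda>n. r (Suc n) - r n)"
  proof (rule telescope_summable)
    have "incseq r" using rmono by (rule incseq_SucI)
    then show "r \<longlonglongrightarrow> lim r"
      using r01 by (metis Bseq_mono_convergent convergent_LIMSEQ_iff incseq_bounded incseq_def)
  qed
  then have "summable (\<lambda>n. y (Suc n) - y n)"
    by (rule summable_comparison_test[rotated]) (use step in auto)
  then have "convergent (\<lambda>n. \<Sum>k<n. y (Suc k) - y k)"
    by (simp add: summable_iff_convergent)
  then have "convergent y" by (simp add: sum_lessThan_telescope y(1))
  then obtain l where l: "y \<longlonglongrightarrow> l" by (auto simp: convergent_def)
  have fix_l: "l = (1/2) *\<^sub>R (b + l * l)"
  proof (rule LIMSEQ_unique)
    show "(\<lambda>n. y (Suc n)) \<longlonglongrightarrow> l" using l by (rule LIMSEQ_Suc)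
    show "(\<lambda>n. y (Suc n)) \<longlonglongrightarrow> (1/2) *\<^sub>R (b + l * l)"
      unfolding y by (intro tendsto_intros l)
  qed
  have nl: "norm l \<le> 1"
  proof (rule LIMSEQ_le_const2)
    show "(\<lambda>n. norm (y n)) \<longlonglongrightarrow> norm l" by (intro tendsto_intros l)
    show "\<exists>N. \<forall>n\<ge>N. norm (y n) \<le> 1" using yr r01 order_trans by blast
  qed
  have "adj b = b" by (simp add: b_def)
  then have yadj: "adj (y n) = y n" for n by (induction n) (simp_all add: y)
  have "adj l = l"
  proof (rule adj_eqI)
    fix v w
    have ev: "(\<lambda>n. y n \<cdot> v) \<longlonglongrightarrow> l \<cdot> v" for v
      by (rule bounded_linear.tendsto[OF bounded_linear_bop_eval l])
    have "(\<lambda>n. inner (y n \<cdot> v) w) \<longlonglongrightarrow> inner (l \<cdot> v) w"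
      and "(\<lambda>n. inner v (y n \<cdot> w)) \<longlonglongrightarrow> inner v (l \<cdot> w)"
      by (intro tendsto_intros ev)+
    then show "inner (l \<cdot> v) w = inner v (l \<cdot> w)"
      using LIMSEQ_unique by (simp add: inner_adj yadj)
  qed
  moreover have "0 \<le> inner ((1 - l) \<cdot> v) v" for v
  proof -
    have "inner (l \<cdot> v) v \<le> norm (l \<cdot> v) * norm v" by (rule norm_cauchy_schwarz)
    also have "\<dots> \<le> (norm l * norm v) * norm v" by (intro mult_right_mono norm_bop_apply) simp
    also have "\<dots> \<le> (1 * norm v) * norm v" by (intro mult_right_mono nl) auto
    finally show ?thesis by (simp add: inner_simps power2_norm_eq_inner[symmetric] power2_eq_square)
  qed
  ultimately have "positive_op (1 - l)" by (simp add: positive_op_iff)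
  moreover have "(1 - l) * (1 - l) = adj x * x"
  proof -
    have "l + l = b + l * l" using fix_l by (metis scaleR_half_double scaleR_add_right)
    then show ?thesis by (simp add: b_def algebra_simps)
  qed
  moreover have "z * (1 - l) = (1 - l) * z" if "z * (adj x * x) = (adj x * x) * z" for z
  proof -
    have "z * b = b * z" using that by (simp add: b_def algebra_simps)
    then have "(\<lambda>n. z * y n) = (\<lambda>n. y n * z)" using ycomm by blast
    moreover have "(\<lambda>n. z * y n) \<longlonglongrightarrow> z * l" "(\<lambda>n. y n * z) \<longlonglongrightarrow> l * z" by (intro tendsto_intros l)+
    ultimately have "z * l = l * z" using LIMSEQ_unique by metis
    then show ?thesis by (simp add: algebra_simps)
  qed
  ultimately show ?thesis by metis
qed

lemma ex_sqrt:
  fixes x :: "'a :: complex_hilbert bop"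
  shows "\<exists>s. positive_op s \<and> s * s = adj x * x \<and>
    (\<forall>z. z * (adj x * x) = (adj x * x) * z \<longrightarrow> z * s = s * z)"
proof (cases "x = 0")
  case True
  have "positive_op (0 :: 'a bop)" by (simp add: positive_op_iff)
  moreover have "0 * 0 = adj x * x" by (simp add: True)
  moreover have "z * 0 = 0 * z" for z :: "'a bop" by simp
  ultimately show ?thesis by blast
next
  case False
  define c where "c = norm x"
  define x' where "x' = inverse c *\<^sub>R x"
  have c: "c > 0" "norm x' \<le> 1" using False by (auto simp: c_def x'_def)
  have x: "x = c *\<^sub>R x'" using c by (simp add: x'_def)
  obtain s where s: "positive_op s" "s * s = adj x' * x'"
    "\<And>z. z * (adj x' * x') = (adj x' * x') * z \<Longrightarrow> z * s = s * z"
    using ex_sqrt_contraction[OF c(2)] by blast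
  have "positive_op (c *\<^sub>R s)" using s(1) c(1) by (simp add: positive_op_iff)
  moreover have "(c *\<^sub>R s) * (c *\<^sub>R s) = adj x * x" using s(2) by (simp add: x)
  moreover have "z * (c *\<^sub>R s) = (c *\<^sub>R s) * z" if "z * (adj x * x) = (adj x * x) * z" for z
    using s(3)[of z] that c(1) by (simp add: x)
  ultimately show ?thesis by blast
qed

text \<open>The definite description in \<open>sqrt_op\<close> requires uniqueness among all
  positive roots. Any root commutes with its own square, hence with the root \<open>s\<close> of
  \<open>ex_sqrt\<close>, and the commuting case applies.\<close>

lemma abs_op_properties:
  shows positive_abs_op: "positive_op (abs_op x)"
    and abs_op_square: "abs_op x * abs_op x = adj x * x"
    and abs_op_commute: "z * (adj x * x) = (adj x * x) * z \<Longrightarrow> z * abs_op x = abs_op x * z"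
proof -
  obtain s where s: "positive_op s" "s * s = adj x * x"
    "\<And>z. z * (adj x * x) = (adj x * x) * z \<Longrightarrow> z * s = s * z"
    using ex_sqrt by blast
  have abs: "abs_op x = s"
    unfolding abs_op_def sqrt_op_def
  proof (rule the_equality)
    fix t assume t: "positive_op t \<and> t * t = adj x * x"
    then have "t * s = s * t" by (intro s(3)) (metis mult.assoc)
    with t s(1,2) show "t = s" by (metis commuting_positive_sqrt_unique)
  qed (intro conjI s(1,2))
  show "positive_op (abs_op x)" "abs_op x * abs_op x = adj x * x"
    "z * (adj x * x) = (adj x * x) * z \<Longrightarrow> z * abs_op x = abs_op x * z"
    unfolding abs by (rule s)+
qed

lemma adj_abs_op [simp]: "adj (abs_op x) = abs_op x"
  using positive_abs_op positive_op_iff by blast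

lemma norm_abs_op_apply: "norm (abs_op x \<cdot> v) = norm (x \<cdot> v)"
proof -
  have "inner (abs_op x \<cdot> v) (abs_op x \<cdot> v) = inner v ((abs_op x * abs_op x) \<cdot> v)"
    by (simp add: inner_adj)
  also have "\<dots> = inner (x \<cdot> v) (x \<cdot> v)"
    unfolding abs_op_square by (simp add: inner_adj)
  finally show ?thesis by (simp add: norm_eq_sqrt_inner)
qed

text \<open>The Hilbert space is the orthogonal sum of the closure of the range of \<open>h\<close> and its kernel.\<close>

lemma bop_eq_0_if_selfadjoint:
  assumes h: "adj h = h" and ah: "a * h = 0" and ker: "\<And>v. h \<cdot> v = 0 \<Longrightarrow> a \<cdot> v = 0"
  shows "a = 0"
proof (rule bop_eqI)
  fix v
  have "\<exists>b. \<forall>w. b \<cdot> w \<in> closure (bop_apply h ` UNIV) \<and>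
      (\<forall>v\<in>UNIV. inner (b \<cdot> w) (h \<cdot> v) = inner w (h \<cdot> v))"
    by (rule ex_weak_factor[where C = 1]) auto
  then obtain b where b: "\<And>w. b \<cdot> w \<in> closure (range (bop_apply h))"
    "\<And>w v. inner (b \<cdot> w) (h \<cdot> v) = inner w (h \<cdot> v)" by blast
  have "inner (h \<cdot> (v - b \<cdot> v)) w = 0" for w
    by (simp only: inner_adj h) (simp add: inner_diff_left b(2))
  then have "h \<cdot> (v - b \<cdot> v) = 0" using inner_eq_zero_iff by blast
  then have "a \<cdot> (v - b \<cdot> v) = 0" by (rule ker)
  moreover have "a \<cdot> b \<cdot> v = 0"
  proof -
    have "inner (adj a \<cdot> a \<cdot> b \<cdot> v) (b \<cdot> v) = 0"
    proof (rule inner_closure_eq_0[OF b(1)])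
      fix s assume "s \<in> range (bop_apply h)"
      then obtain t where "s = h \<cdot> t" by blast
      moreover have "a \<cdot> h \<cdot> t = 0" using ah by (metis bop_apply_simps(1,5))
      ultimately show "inner (adj a \<cdot> a \<cdot> b \<cdot> v) s = 0" by (simp add: inner_adj_left)
    qed
    then have "inner (a \<cdot> b \<cdot> v) (a \<cdot> b \<cdot> v) = 0" by (simp add: inner_adj_left)
    then show ?thesis by simp
  qed
  ultimately show "a \<cdot> v = 0 \<cdot> v" by simp
qed

section \<open>Polar decompositions and orthogonal projections\<close>

text \<open>\<open>x\<close> and its modulus have equal norms on every vector, so
  \<open>ex_weak_factor\<close> yields an operator \<open>b\<close> whose adjoint \<open>u\<close>
  carries \<open>?h \<cdot> v\<close> to \<open>x \<cdot> v\<close>.\<close>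

lemma polar_decomposition:
  fixes x :: "'a :: complex_hilbert bop"
  obtains u where "polar_part x u" "adj u * u * abs_op x = abs_op x"
proof -
  let ?h = "abs_op x"
  have "\<exists>b. \<forall>w. b \<cdot> w \<in> closure (bop_apply ?h ` UNIV) \<and>
      (\<forall>v\<in>UNIV. inner (b \<cdot> w) (?h \<cdot> v) = inner w (x \<cdot> v))"
    by (rule ex_weak_factor[where C = 1]) (auto simp: norm_abs_op_apply)
  then obtain b where b: "\<And>w. b \<cdot> w \<in> closure (range (bop_apply ?h))"
    "\<And>w v. inner (b \<cdot> w) (?h \<cdot> v) = inner w (x \<cdot> v)" by blast
  define u where "u = adj b"
  have x: "x = u * ?h"
  proof (rule bop_eqI)
    fix v
    have "inner w (x \<cdot> v) = inner w (u \<cdot> ?h \<cdot> v)" for w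
      using b(2)[of w v] by (simp add: u_def inner_adj)
    then show "x \<cdot> v = (u * ?h) \<cdot> v" by (metis bop_apply_simps(1) vector_eq_ldot)
  qed
  \<comment> \<open>\<open>b\<close> takes values in the closure of the range of the selfadjoint
    \<open>?h\<close>, which is orthogonal to the kernel of \<open>?h\<close>.\<close>
  have ker: "u \<cdot> v = 0" if "?h \<cdot> v = 0" for v
  proof -
    have "inner v (b \<cdot> u \<cdot> v) = 0"
    proof (rule inner_closure_eq_0[OF b(1)])
      fix s assume "s \<in> range (bop_apply ?h)"
      then obtain t where "s = ?h \<cdot> t" by blast
      then have "inner v s = inner (?h \<cdot> v) t" by (simp add: inner_adj)
      with that show "inner v s = 0" by simp
    qed
    then have "inner (u \<cdot> v) (u \<cdot> v) = 0" by (simp add: u_def inner_adj)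
    then show ?thesis by simp
  qed
  \<comment> \<open>The difference of the two sides is killed by \<open>?h\<close>, hence by
    \<open>u\<close>; therefore its adjoint times itself is 0.\<close>
  have h_u: "adj u * u * ?h = ?h"
  proof -
    have "?h * (adj u * u * ?h - ?h) = 0"
    proof -
      have "?h * (adj u * u * ?h) = adj x * x"
        by (metis adj_abs_op adj_simps(1) mult.assoc x)
      then show ?thesis by (simp add: algebra_simps abs_op_square)
    qed
    then have k: "?h \<cdot> (adj u * u * ?h - ?h) \<cdot> v = 0" for v
      by (metis bop_apply_simps(1,5))
    then have "u \<cdot> (adj u * u * ?h - ?h) \<cdot> v = 0" for v by (rule ker)
    then have "u * (adj u * u * ?h - ?h) = 0" by (intro bop_eqI) simp
    then have "(adj u * u) * (adj u * u * ?h - ?h) = 0" by (metis mult.assoc mult_zero_right)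
    then have "adj (adj u * u * ?h - ?h) * (adj u * u * ?h - ?h) = 0"
      using \<open>?h * (adj u * u * ?h - ?h) = 0\<close> by (simp add: algebra_simps)
    then have "adj u * u * ?h - ?h = 0" by (rule adj_mult_self_eq_0)
    then show ?thesis by simp
  qed
  \<comment> \<open>Idempotency holds on the range of \<open>?h\<close> by \<open>h_u\<close> and on
    its kernel by \<open>ker\<close>.\<close>
  have proj: "(adj u * u) * (adj u * u) - adj u * u = 0"
  proof (rule bop_eq_0_if_selfadjoint[of ?h])
    show "(adj u * u * (adj u * u) - adj u * u) * ?h = 0"
      using h_u by (simp add: algebra_simps)
  qed (auto simp: ker)
  have "u \<cdot> v = 0 \<longleftrightarrow> x \<cdot> v = 0" for v
  proof
    assume "u \<cdot> v = 0"
    have "?h * (adj u * u) = ?h" using arg_cong[OF h_u, of adj] by (simp add: mult.assoc)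
    then have "?h \<cdot> v = ?h \<cdot> adj u \<cdot> u \<cdot> v" by (metis bop_apply_simps(1))
    then show "x \<cdot> v = 0" using \<open>u \<cdot> v = 0\<close> x by (metis bop_apply_linear(4) bop_apply_simps(1))
  next
    assume "x \<cdot> v = 0"
    then show "u \<cdot> v = 0" using ker norm_abs_op_apply[of x v] by simp
  qed
  then have "polar_part x u"
    using proj x by (simp add: polar_part_def partial_isometry_def projection_def)
  then show thesis using h_u that by blast
qed

text \<open>The definite description also needs uniqueness: a projection \<open>q\<close> with range
  \<open>S\<close> fixes \<open>S\<close>, so \<open>q \<cdot> v\<close> and \<open>v\<close> have
  the same inner products with \<open>S\<close>, which determines \<open>q \<cdot> v\<close> within
  \<open>S\<close>.\<close>

lemma ex_projection_onto:
  fixes S :: "'a :: complex_hilbert set"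
  assumes S: "closed S" "0 \<in> S" "\<And>v w. v \<in> S \<Longrightarrow> w \<in> S \<Longrightarrow> v + w \<in> S"
    "\<And>c v. v \<in> S \<Longrightarrow> c *\<^sub>C v \<in> S"
  shows "projection (projection_onto S) \<and> range (bop_apply (projection_onto S)) = S"
proof -
  have "\<exists>b. \<forall>w. b \<cdot> w \<in> closure (bop_apply 1 ` S) \<and> (\<forall>v\<in>S. inner (b \<cdot> w) (1 \<cdot> v) = inner w (1 \<cdot> v))"
    by (rule ex_weak_factor[where C = 1]) (use S in auto)
  then obtain b where bS: "\<And>w. b \<cdot> w \<in> S" and b: "\<And>w v. v \<in> S \<Longrightarrow> inner (b \<cdot> w) v = inner w v"
    using S(1) by auto
  have diff: "v - w \<in> S" if "v \<in> S" "w \<in> S" for v w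
    using S(3)[OF that(1) S(4)[OF that(2), of "- 1"]] by simp
  have eq: "v = w" if "v \<in> S" "w \<in> S" "\<And>s. s \<in> S \<Longrightarrow> inner v s = inner w s" for v w
  proof -
    have "inner (v - w) (v - w) = 0"
      using that(3)[OF diff[OF that(1,2)]] by (simp add: inner_diff_left)
    then show ?thesis by simp
  qed
  have fixS: "b \<cdot> v = v" if "v \<in> S" for v
    by (rule eq) (use that bS b in auto)
  have "adj b = b"
  proof (rule adj_eqI)
    fix v w
    show "inner (b \<cdot> v) w = inner v (b \<cdot> w)"
      using b[OF bS[of v], of w] b[OF bS[of w], of v] by (simp add: inner_commute)
  qed
  moreover have "b * b = b" by (rule bop_eqI) (simp add: fixS bS)
  moreover have "range (bop_apply b) = S"
    using bS fixS by (auto simp: image_iff) metis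
  ultimately have P: "projection b \<and> range (bop_apply b) = S" by (simp add: projection_def)
  have uniq: "q = b" if q: "projection q \<and> range (bop_apply q) = S" for q
  proof (rule bop_eqI)
    fix v
    have qS: "q \<cdot> w \<in> S" for w using q by blast
    show "q \<cdot> v = b \<cdot> v"
    proof (rule eq[OF qS bS])
      fix s assume s: "s \<in> S"
      then obtain t where t: "s = q \<cdot> t" using q by blast
      have "q \<cdot> s = s"
        unfolding t using q by (metis bop_apply_simps(1) projection_def)
      then have "inner (q \<cdot> v) s = inner v s"
        using q inner_adj[of q v s] by (simp add: projection_def)
      then show "inner (q \<cdot> v) s = inner (b \<cdot> v) s" by (simp add: b s)
    qed
  qed
  have "projection_onto S = b"
    unfolding projection_onto_def by (rule the_equality[where a = b]) (fact P, rule uniq)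
  with P show ?thesis by simp
qed

section \<open>Commutation and skewness of the polar part\<close>

lemma polar_part_kernel:
  assumes "polar_part x u"
  shows "u \<cdot> v = 0 \<longleftrightarrow> abs_op x \<cdot> v = 0"
  using assms norm_abs_op_apply[of x v] by (metis norm_eq_zero polar_part_def)

text \<open>The commutator of \<open>y\<close> and \<open>u\<close> vanishes on the range of the
  modulus, where \<open>u\<close> acts through \<open>x\<close>, and on its kernel, which
  \<open>y\<close> preserves and \<open>u\<close> kills.\<close>

lemma polar_part_commute:
  assumes u: "polar_part x u" and y: "y * x = x * y" "y * abs_op x = abs_op x * y"
  shows "y * u = u * y"
proof -
  have x: "x = u * abs_op x" using u by (simp add: polar_part_def)
  have "y * u - u * y = 0"
  proof (rule bop_eq_0_if_selfadjoint[of "abs_op x"])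
    have "y * u * abs_op x = y * x" using x by (simp add: mult.assoc)
    moreover have "u * y * abs_op x = x * y" using x y(2) by (metis mult.assoc)
    ultimately show "(y * u - u * y) * abs_op x = 0" by (simp add: left_diff_distrib y(1))
  next
    fix v assume v: "abs_op x \<cdot> v = 0"
    have "abs_op x \<cdot> y \<cdot> v = y \<cdot> abs_op x \<cdot> v" using y(2) by (metis bop_apply_simps(1))
    then have "u \<cdot> y \<cdot> v = 0" "u \<cdot> v = 0" using v polar_part_kernel[OF u] by simp_all
    then show "(y * u - u * y) \<cdot> v = 0" by simp
  qed simp
  then show ?thesis by simp
qed

text \<open>The last clause asks for commutation with the modulus only, not with \<open>x\<close>.
  It will place \<open>adj u * u\<close> in \<open>N\<close> although \<open>u\<close> itself lies
  in the kernel of \<open>E\<close>.\<close>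

lemma polar_part_initial_projection:
  assumes u: "polar_part x u"
  shows "adj u * u * abs_op x = abs_op x"
    and "u * (adj u * u) = u"
    and "y * abs_op x = abs_op x * y \<Longrightarrow> y * (adj u * u) = adj u * u * y"
proof -
  let ?h = "abs_op x" and ?q = "adj u * u"
  \<comment> \<open>Polar parts are unique, so the identity known for the constructed
    \<open>u'\<close> passes to the given \<open>u\<close>.\<close>
  obtain u' where u': "polar_part x u'" "adj u' * u' * ?h = ?h"
    by (rule polar_decomposition)
  have "u - u' = 0"
  proof (rule bop_eq_0_if_selfadjoint[of ?h])
    show "(u - u') * ?h = 0" using u u'(1) by (simp add: polar_part_def left_diff_distrib)
  qed (simp_all add: polar_part_kernel[OF u, symmetric] polar_part_kernel[OF u'(1), symmetric],
      metis polar_part_kernel u u'(1))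
  then show qh: "?q * ?h = ?h" using u'(2) by simp
  have "u * ?q - u = 0"
  proof (rule bop_eq_0_if_selfadjoint[of ?h])
    show "(u * ?q - u) * ?h = 0" by (simp only: left_diff_distrib mult.assoc[of u] qh) simp
  qed (simp_all add: polar_part_kernel[OF u, symmetric])
  then show "u * ?q = u" by simp
  assume y: "y * ?h = ?h * y"
  have "y * ?q - ?q * y = 0"
  proof (rule bop_eq_0_if_selfadjoint[of ?h])
    have "?q * y * ?h = ?h * y" using qh y by (metis mult.assoc)
    moreover have "y * ?q * ?h = y * ?h" using qh by (metis mult.assoc)
    ultimately show "(y * ?q - ?q * y) * ?h = 0" by (simp add: left_diff_distrib y)
  next
    fix v assume v: "?h \<cdot> v = 0"
    have "?h \<cdot> y \<cdot> v = y \<cdot> ?h \<cdot> v" using y by (metis bop_apply_simps(1))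
    then have "u \<cdot> y \<cdot> v = 0" "u \<cdot> v = 0" using v polar_part_kernel[OF u] by simp_all
    then show "(y * ?q - ?q * y) \<cdot> v = 0" by simp
  qed simp
  then show "y * ?q = ?q * y" by simp
qed

text \<open>A skew-adjoint \<open>x\<close> commutes with its modulus, hence so do \<open>u\<close>
  and \<open>adj u\<close>. On the range of the modulus they act as \<open>x\<close> and
  \<open>- x\<close>; on its kernel both vanish.\<close>

lemma polar_part_skew:
  assumes u: "polar_part x u" and x: "adj x = - x"
  shows "u * abs_op x = abs_op x * u" and "adj u = - u"
proof -
  let ?h = "abs_op x"
  have xuh: "x = u * ?h" using u by (simp add: polar_part_def)
  have xh: "x * ?h = ?h * x" by (rule abs_op_commute) (simp add: x mult.assoc)
  then show uh: "u * ?h = ?h * u" using polar_part_commute[OF u, of ?h] by simp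
  have hu: "adj u * ?h = ?h * adj u" using arg_cong[OF uh, of adj] by simp
  have "u + adj u = 0"
  proof (rule bop_eq_0_if_selfadjoint[of ?h])
    have "adj u * ?h = - x" using arg_cong[OF xuh, of adj] x hu by simp
    then show "(u + adj u) * ?h = 0" using xuh by (simp add: distrib_right)
  next
    fix v assume v: "?h \<cdot> v = 0"
    have "?h \<cdot> adj u \<cdot> v = 0" using v hu by (metis bop_apply_simps(1) bop_apply_linear(4))
    then have "u \<cdot> adj u \<cdot> v = 0" using polar_part_kernel[OF u] by simp
    then have "inner (adj u \<cdot> v) (adj u \<cdot> v) = 0" by (simp add: inner_adj_left)
    then have "adj u \<cdot> v = 0" by simp
    then show "(u + adj u) \<cdot> v = 0" using v polar_part_kernel[OF u] by simp
  qed simp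
  then show "adj u = - u" by (simp add: eq_neg_iff_add_eq_0 add.commute)
qed

section \<open>Functional calculus and one-parameter groups\<close>

lemma sums_commute:
  fixes f :: "nat \<Rightarrow> 'b :: real_normed_algebra"
  assumes "f sums s" and "\<And>n. a * f n = f n * a"
  shows "a * s = s * a"
proof -
  have "(\<lambda>n. a * f n) sums (a * s)" "(\<lambda>n. f n * a) sums (s * a)"
    using assms(1) by (auto intro: sums_mult sums_mult2)
  then show ?thesis using assms(2) sums_unique2 by simp
qed

lemma commute_power:
  fixes a b :: "'b :: monoid_mult"
  assumes "a * b = b * a"
  shows "a * b ^ n = b ^ n * a"
  using power_commuting_commutes[of b a n] assms by simp

lemma commute_exp_cos_sin:
  fixes a b :: "'b :: {real_normed_algebra_1, banach}"
  assumes "a * b = b * a"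
  shows "a * exp b = exp b * a" "a * cos b = cos b * a" "a * sin b = sin b * a"
  by (rule sums_commute[OF exp_converges] sums_commute[OF cos_converges] sums_commute[OF sin_converges],
      simp add: commute_power[OF assms])+

text \<open>Euler's formula with hypothesis on \<open>u * k\<close> rather than
  \<open>u * u = - 1\<close>, because the polar part is only a partial isometry. Even powers of
  \<open>u * k\<close> are signed powers of \<open>k\<close>; odd ones retain a single factor
  \<open>u\<close>.\<close>

lemma exp_eq_cos_plus_sin:
  fixes u k :: "'b :: {real_normed_algebra_1, banach}"
  assumes uk: "u * k = k * u" and sq: "(u * k) * (u * k) = - (k * k)"
  shows "exp (u * k) = cos k + u * sin k"
proof (rule sums_unique2[OF exp_converges])
  have ev: "(u * k) ^ (2 * m) = (- 1) ^ m *\<^sub>R k ^ (2 * m)" for m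
  proof (induction m)
    case (Suc m)
    have "(u * k) ^ (2 * Suc m) = ((u * k) * (u * k)) * (u * k) ^ (2 * m)"
      by (simp add: mult.assoc)
    also have "\<dots> = (- 1) ^ Suc m *\<^sub>R k ^ (2 * Suc m)"
      unfolding sq Suc by (simp add: mult.assoc)
    finally show ?case .
  qed simp
  have "(u * k) ^ n /\<^sub>R fact n = cos_coeff n *\<^sub>R k ^ n + u * (sin_coeff n *\<^sub>R k ^ n)" for n
  proof (cases "even n")
    case True
    then obtain m where m: "n = 2 * m" by blast
    then have "(u * k) ^ n = (- 1) ^ m *\<^sub>R k ^ n" by (simp only: ev)
    then show ?thesis using m by (simp add: cos_coeff_def sin_coeff_def divide_inverse mult.commute)
  next
    case False
    then obtain m where m: "n = 2 * m + 1" by (blast elim: oddE)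
    then have "(u * k) ^ n = u * ((- 1) ^ m *\<^sub>R k ^ n)"
      using ev[of m] by (simp add: mult.assoc)
    then show ?thesis using m by (simp add: cos_coeff_def sin_coeff_def divide_inverse mult.commute)
  qed
  then show "(\<lambda>n. (u * k) ^ n /\<^sub>R fact n) sums (cos k + u * sin k)"
    using sums_add[OF cos_converges[of k] sums_mult[OF sin_converges[of k], of u]] by simp
qed

section \<open>Conjugation curves: derivatives, splitting and polar form\<close>

lemma conj_curve_0 [simp]: "conj_curve w a 0 = a"
  by (simp add: conj_curve_def)

text \<open>The derivative is again a conjugation curve with the same generator, now applied to a
  commutator, so differentiation can be iterated algebraically.\<close>

lemma conj_curve_has_vector_derivative:
  "(conj_curve w a has_vector_derivative conj_curve w (w * a - a * w) t) (at t)"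
proof -
  let ?e = "\<lambda>s. exp (s *\<^sub>R w)" and ?f = "\<lambda>s. exp (s *\<^sub>R (- w))"
  have e: "((\<lambda>s. ?e s * a) has_vector_derivative (?e t * w) * a) (at t)"
    using has_vector_derivative_mult[OF exp_scaleR_has_vector_derivative_right[of w t UNIV]
        has_vector_derivative_const[of a]] by simp
  have "((\<lambda>s. ?e s * a * ?f s) has_vector_derivative
      (?e t * a) * (?f t * (- w)) + (?e t * w) * a * ?f t) (at t)"
    by (rule has_vector_derivative_mult[OF e exp_scaleR_has_vector_derivative_right])
  moreover have "(?e t * a) * (?f t * (- w)) + (?e t * w) * a * ?f t = conj_curve w (w * a - a * w) t"
    unfolding exp_times_scaleR_commute[of t "- w"]
    by (simp add: conj_curve_def algebra_simps)
  moreover have "(\<lambda>s. ?e s * a * ?f s) = conj_curve w a"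
    by (simp add: conj_curve_def fun_eq_iff)
  ultimately show ?thesis by simp
qed

lemma conj_curve_eq_imp_commutator_eq:
  assumes "conj_curve w a = conj_curve z b"
  shows "conj_curve w (w * a - a * w) = conj_curve z (z * b - b * z)"
proof
  fix t
  show "conj_curve w (w * a - a * w) t = conj_curve z (z * b - b * z) t"
    using vector_derivative_unique_at conj_curve_has_vector_derivative assms by metis
qed

text \<open>Since \<open>w\<close> and \<open>d\<close> commute, the exponential factorizes; the
  factor from \<open>d\<close> commutes with \<open>a\<close> and cancels against its
  inverse.\<close>

lemma conj_curve_orthogonal_summand:
  assumes wd: "w * d = 0" "d * w = 0" and ap: "d * a = 0" "a * d = 0"
  shows "conj_curve (w + d) a t = conj_curve w a t"
proof -
  let ?W = "t *\<^sub>R w" and ?D = "t *\<^sub>R d"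
  have neg: "- (?W + ?D) = - ?D + - ?W" by simp
  have e: "exp (?W + ?D) = exp ?W * exp ?D" "exp (- (?W + ?D)) = exp (- ?D) * exp (- ?W)"
    unfolding neg by (rule exp_add_commuting, simp add: wd)+
  have "a * exp ?D = exp ?D * a" using ap by (intro commute_exp_cos_sin) simp
  then have "exp ?D * a * exp (- ?D) = a" by (metis exp_minus_inverse mult.assoc mult.right_neutral)
  moreover have "exp ?W * exp ?D * a * (exp (- ?D) * exp (- ?W))
      = exp ?W * (exp ?D * a * exp (- ?D)) * exp (- ?W)"
    by (simp only: mult.assoc)
  ultimately show ?thesis
    by (simp only: conj_curve_def scaleR_add_right e)
qed

text \<open>Double-angle formula read off from the difference of
  \<open>exp (2 *\<^sub>R (u * k))\<close> and its inverse, computed directly and by squaring.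
  Euler's formula only sees the sine multiplied by \<open>u\<close>, hence the factor.\<close>

lemma sin_double_polar:
  fixes u k :: "'b :: {real_normed_algebra_1, banach}"
  assumes uk: "u * k = k * u" and sq: "(u * k) * (u * k) = - (k * k)"
  shows "u * sin (2 *\<^sub>R k) = 2 *\<^sub>R (u * (sin k * cos k))"
proof -
  have e: "exp (r *\<^sub>R (u * k)) = cos (r *\<^sub>R k) + u * sin (r *\<^sub>R k)" for r
    using exp_eq_cos_plus_sin[of u "r *\<^sub>R k"] uk sq by simp
  have dbl: "exp (r *\<^sub>R (u * k)) * exp (r *\<^sub>R (u * k)) = exp ((2 * r) *\<^sub>R (u * k))" for r
    by (subst exp_add_commuting[symmetric]) (simp_all add: scaleR_2[symmetric])
  have comm: "u * sin k = sin k * u" "u * cos k = cos k * u" "cos k * sin k = sin k * cos k"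
    using uk by (auto intro!: commute_exp_cos_sin commute_exp_cos_sin[symmetric])
  have "2 *\<^sub>R (u * sin (2 *\<^sub>R k)) = exp (2 *\<^sub>R (u * k)) - exp ((- 2) *\<^sub>R (u * k))"
    using e[of 2] e[of "- 2"] by (simp only: scaleR_minus_left cos_minus sin_minus) (simp add: scaleR_2)
  also have "\<dots> = (cos k + u * sin k) * (cos k + u * sin k) - (cos k - u * sin k) * (cos k - u * sin k)"
    using dbl[of 1] dbl[of "- 1"] e[of 1] e[of "- 1"] by simp
  also have "\<dots> = 2 *\<^sub>R (cos k * (u * sin k) + u * sin k * cos k)"
    by (simp add: algebra_simps scaleR_2)
  also have "cos k * (u * sin k) = u * sin k * cos k"
    using comm by (metis mult.assoc)
  finally have "2 *\<^sub>R (u * sin (2 *\<^sub>R k)) = 2 *\<^sub>R (2 *\<^sub>R (u * (sin k * cos k)))"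
    by (simp add: scaleR_2 mult.assoc)
  then show ?thesis by (rule scaleR_left_imp_eq[rotated]) simp
qed

text \<open>Euler's formula on both sides of \<open>p\<close> gives four products. The two mixed
  ones combine to the double-angle term.\<close>

lemma conj_curve_polar:
  fixes u h p :: "'a :: complex_hilbert bop"
  assumes uh: "u * h = h * u" and ph: "p * h = h * p" and sq: "(u * h) * (u * h) = - (h * h)"
  shows "conj_curve (u * h) p t = p * (cos (t *\<^sub>R h))\<^sup>2 - u * p * u * (sin (t *\<^sub>R h))\<^sup>2
    + (1/2) *\<^sub>R ((u * p - p * u) * sin ((2 * t) *\<^sub>R h))"
proof -
  define k where "k = t *\<^sub>R h"
  let ?c = "cos k" and ?s = "sin k"
  have uk: "u * k = k * u" and pk: "p * k = k * p" and sqk: "(u * k) * (u * k) = - (k * k)"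
    using uh ph sq by (simp_all add: k_def)
  have comm: "?s * u = u * ?s" "?c * u = u * ?c" "?c * ?s = ?s * ?c" "?s * p = p * ?s" "?c * p = p * ?c"
    using uk pk by (auto intro!: commute_exp_cos_sin commute_exp_cos_sin[symmetric])
  \<comment> \<open>Together with \<open>comm\<close> this normalizes words: sines and cosines move
    right past \<open>u\<close> and \<open>p\<close>, sines before cosines, while the order of
    \<open>u\<close> and \<open>p\<close> is kept.\<close>
  have assoc: "a * (b * c) = b * (a * c)" if "a * b = b * a" for a b c :: "'a bop"
    using that by (simp flip: mult.assoc)
  note comms = comm comm[THEN assoc] mult.assoc power2_eq_square
  have e: "exp (u * k) = ?c + u * ?s" "exp (- (u * k)) = ?c - u * ?s"
    using exp_eq_cos_plus_sin[of u k] exp_eq_cos_plus_sin[of u "- k"] uk sqk by simp_all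
  have sin2: "u * sin (2 *\<^sub>R k) = 2 *\<^sub>R (u * (?s * ?c))"
    by (rule sin_double_polar[OF uk sqk])
  have p2: "p * sin (2 *\<^sub>R k) = sin (2 *\<^sub>R k) * p"
    using pk by (intro commute_exp_cos_sin) simp
  have "(u * p - p * u) * sin (2 *\<^sub>R k) = (u * sin (2 *\<^sub>R k)) * p - p * (u * sin (2 *\<^sub>R k))"
    using p2 by (simp add: left_diff_distrib mult.assoc)
  also have "\<dots> = 2 *\<^sub>R (u * (?s * ?c) * p - p * (u * (?s * ?c)))"
    unfolding sin2 by (simp add: scaleR_right_diff_distrib)
  finally have half: "(1/2) *\<^sub>R ((u * p - p * u) * sin (2 *\<^sub>R k)) = u * (?s * ?c) * p - p * (u * (?s * ?c))"
    by simp
  have "t *\<^sub>R (u * h) = u * k" by (simp add: k_def)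
  then have "conj_curve (u * h) p t = (?c + u * ?s) * p * (?c - u * ?s)"
    by (simp only: conj_curve_def e)
  also have "\<dots> = ?c * p * ?c - u * ?s * p * u * ?s + u * ?s * p * ?c - ?c * p * u * ?s"
    by (simp add: algebra_simps)
  also have "?c * p * ?c = p * (?c)\<^sup>2" by (simp only: comms)
  also have "u * ?s * p * u * ?s = u * p * u * (?s)\<^sup>2" by (simp only: comms)
  also have "u * ?s * p * ?c = u * (?s * ?c) * p" by (simp only: comms)
  also have "?c * p * u * ?s = p * (u * (?s * ?c))" by (simp only: comms)
  finally have "conj_curve (u * h) p t = p * ?c\<^sup>2 - u * p * u * ?s\<^sup>2
      + (u * (?s * ?c) * p - p * (u * (?s * ?c)))"
    by simp
  then show ?thesis unfolding half[symmetric] by (simp add: k_def)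
qed

section \<open>Von Neumann algebras and the Jones projection\<close>

lemma commutant_closed:
  "1 \<in> commutant S" "0 \<in> commutant S"
  "a \<in> commutant S \<Longrightarrow> b \<in> commutant S \<Longrightarrow> a * b \<in> commutant S"
  "a \<in> commutant S \<Longrightarrow> b \<in> commutant S \<Longrightarrow> a + b \<in> commutant S"
  "a \<in> commutant S \<Longrightarrow> b \<in> commutant S \<Longrightarrow> a - b \<in> commutant S"
  "a \<in> commutant S \<Longrightarrow> - a \<in> commutant S"
  "a \<in> commutant S \<Longrightarrow> c *\<^sub>C a \<in> commutant S"
proof -
  show "a * b \<in> commutant S" if "a \<in> commutant S" "b \<in> commutant S"
    unfolding commutant_def
  proof (intro CollectI ballI)
    fix s assume "s \<in> S"
    then have "s * a = a * s" "s * b = b * s" using that by (auto simp: commutant_def)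
    then show "s * (a * b) = a * b * s" by (metis mult.assoc)
  qed
  show "c *\<^sub>C a \<in> commutant S" if "a \<in> commutant S"
    unfolding commutant_def
  proof (intro CollectI ballI)
    fix s assume "s \<in> S"
    then have "s * a = a * s" using that by (auto simp: commutant_def)
    then have "s \<cdot> a \<cdot> v = a \<cdot> s \<cdot> v" for v by (metis bop_apply_simps(1))
    then show "s * (c *\<^sub>C a) = (c *\<^sub>C a) * s" by (intro bop_eqI) simp
  qed
qed (auto simp: commutant_def distrib_left distrib_right left_diff_distrib right_diff_distrib)

text \<open>Apart from adjoints, these are closure properties of a commutant, applied to
  \<open>A\<close> as the commutant of its commutant.\<close>

lemma von_neumann_algebra_closed:
  assumes "von_neumann_algebra A"
  shows "1 \<in> A" "0 \<in> A" "a \<in> A \<Longrightarrow> adj a \<in> A"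
    "a \<in> A \<Longrightarrow> b \<in> A \<Longrightarrow> a * b \<in> A"
    "a \<in> A \<Longrightarrow> b \<in> A \<Longrightarrow> a + b \<in> A"
    "a \<in> A \<Longrightarrow> b \<in> A \<Longrightarrow> a - b \<in> A"
    "a \<in> A \<Longrightarrow> - a \<in> A"
    "a \<in> A \<Longrightarrow> c *\<^sub>C a \<in> A"
proof -
  have A: "commutant (commutant A) = A" and "\<And>a. a \<in> A \<Longrightarrow> adj a \<in> A"
    using assms by (auto simp: von_neumann_algebra_def)
  then show "a \<in> A \<Longrightarrow> adj a \<in> A" by blast
  show "1 \<in> A" "0 \<in> A"
    "a \<in> A \<Longrightarrow> b \<in> A \<Longrightarrow> a * b \<in> A"
    "a \<in> A \<Longrightarrow> b \<in> A \<Longrightarrow> a + b \<in> A"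
    "a \<in> A \<Longrightarrow> b \<in> A \<Longrightarrow> a - b \<in> A"
    "a \<in> A \<Longrightarrow> - a \<in> A"
    "a \<in> A \<Longrightarrow> c *\<^sub>C a \<in> A"
    by (fact commutant_closed[where S = "commutant A", unfolded A])+
qed

text \<open>Bicommutant membership test; it places moduli, polar parts and initial projections in an
  algebra without any limit argument.\<close>

lemma von_neumann_algebraI_commute:
  assumes "von_neumann_algebra A" and "\<And>y. y \<in> commutant A \<Longrightarrow> y * a = a * y"
  shows "a \<in> A"
proof -
  have "a \<in> commutant (commutant A)" using assms(2) by (simp add: commutant_def)
  with assms(1) show ?thesis by (simp add: von_neumann_algebra_def)
qed

lemma commutantD: "y \<in> commutant A \<Longrightarrow> a \<in> A \<Longrightarrow> y * a = a * y"
  by (simp add: commutant_def)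

lemma abs_op_mem:
  assumes A: "von_neumann_algebra A" and "adj x * x \<in> A"
  shows "abs_op x \<in> A"
  by (rule von_neumann_algebraI_commute[OF A], rule abs_op_commute, rule commutantD) (use assms in auto)

lemma polar_part_mem:
  assumes A: "von_neumann_algebra A" and x: "x \<in> A" and u: "polar_part x u"
  shows "u \<in> A"
proof (rule von_neumann_algebraI_commute[OF A])
  fix y assume y: "y \<in> commutant A"
  have "abs_op x \<in> A"
    by (intro abs_op_mem A von_neumann_algebra_closed(3,4)[OF A] x)
  then show "y * u = u * y"
    using polar_part_commute[OF u] commutantD[OF y] x by blast
qed

section \<open>The Jones projection of an inclusion with trace and expectation\<close>

locale standard_inclusion =
  fixes M N :: "'a :: complex_hilbert bop set"
    and \<tau> :: "'a bop \<Rightarrow> complex" and \<Omega> :: 'a and E :: "'a bop \<Rightarrow> 'a bop"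
  assumes M: "von_neumann_algebra M" and N: "von_neumann_algebra N" and N_sub: "N \<subseteq> M"
    and trace: "normalized_trace M \<tau>" and L2: "standard_L2 M \<tau> \<Omega>"
    and expectation: "trace_preserving_expectation M N \<tau> E"
begin

abbreviation p where "p \<equiv> jones_projection N \<Omega>"

lemmas M_closed = von_neumann_algebra_closed[OF M]
lemmas N_closed = von_neumann_algebra_closed[OF N]

lemma NM: "n \<in> N \<Longrightarrow> n \<in> M"
  using N_sub by blast

lemma E_props:
  shows E_mem: "a \<in> M \<Longrightarrow> E a \<in> N"
    and E_N: "n \<in> N \<Longrightarrow> E n = n"
    and E_bimodule: "a \<in> M \<Longrightarrow> m \<in> N \<Longrightarrow> n \<in> N \<Longrightarrow> E (m * a * n) = m * E a * n"
    and trace_E: "a \<in> M \<Longrightarrow> \<tau> (E a) = \<tau> a"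
    and E_add: "a \<in> M \<Longrightarrow> b \<in> M \<Longrightarrow> E (a + b) = E a + E b"
    and E_scaleC: "a \<in> M \<Longrightarrow> E (c *\<^sub>C a) = c *\<^sub>C E a"
  using expectation by (auto simp: trace_preserving_expectation_def)

lemma E_diff:
  assumes "a \<in> M" "b \<in> M"
  shows "E (a - b) = E a - E b"
  using E_add[OF assms(1) M_closed(7)[OF assms(2)]] E_scaleC[OF assms(2), of "- 1"] by simp

lemma inner_Omega: "a \<in> M \<Longrightarrow> b \<in> M \<Longrightarrow> inner (a \<cdot> \<Omega>) (b \<cdot> \<Omega>) = Re (\<tau> (adj b * a))"
  using L2 by (simp add: standard_L2_def flip: Re_cinner)

lemma trace_0: "\<tau> 0 = 0"
proof -
  have "\<tau> (0 *\<^sub>C 1) = 0 * \<tau> 1" using trace M_closed(1) by (simp add: normalized_trace_def)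
  moreover have "0 *\<^sub>C 1 = (0 :: 'a bop)"
    using scaleR_eq_scaleC_bop[of 0 "1 :: 'a bop"] by simp
  ultimately show ?thesis by simp
qed

text \<open>By traciality \<open>\<parallel>m b \<Omega>\<parallel>\<^sup>2 = \<langle>b b\<^sup>* \<Omega>, m\<^sup>* m \<Omega>\<rangle>\<close>.\<close>

lemma Omega_separating:
  assumes m: "m \<in> M" and "m \<cdot> \<Omega> = 0"
  shows "m = 0"
proof (rule bop_eqI)
  fix v
  have 0: "m \<cdot> b \<cdot> \<Omega> = 0" if b: "b \<in> M" for b
  proof -
    have mem: "m * b \<in> M" "adj m * m \<in> M" "b * adj b \<in> M"
      using m b by (simp_all add: M_closed)
    have "adj (m * b) * (m * b) = adj b * ((adj m * m) * b)" by (simp add: mult.assoc)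
    then have "\<tau> (adj (m * b) * (m * b)) = \<tau> (((adj m * m) * b) * adj b)"
      using trace b mem M_closed by (simp add: normalized_trace_def)
    also have "((adj m * m) * b) * adj b = adj (adj m * m) * (b * adj b)"
      by (simp add: mult.assoc)
    finally have "inner ((m * b) \<cdot> \<Omega>) ((m * b) \<cdot> \<Omega>) = inner ((b * adj b) \<cdot> \<Omega>) ((adj m * m) \<cdot> \<Omega>)"
      using mem by (simp only: inner_Omega)
    then show ?thesis using assms(2) by simp
  qed
  have "adj m \<cdot> m \<cdot> v = 0"
  proof -
    have "v' \<in> closure ((\<lambda>a. a \<cdot> \<Omega>) ` M)" for v' using L2 by (simp add: standard_L2_def)
    then have "inner (adj m \<cdot> m \<cdot> v) v' = 0" for v'
      by (rule inner_closure_eq_0) (use 0 in \<open>auto simp: inner_adj_left\<close>)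
    then show ?thesis using inner_eq_zero_iff by blast
  qed
  then have "inner (m \<cdot> v) (m \<cdot> v) = 0" by (metis inner_adj_left inner_commute inner_zero_right)
  then show "m \<cdot> v = 0 \<cdot> v" by simp
qed

lemma p_projection: "projection p" and range_p: "range (bop_apply p) = closure ((\<lambda>a. a \<cdot> \<Omega>) ` N)"
proof -
  let ?V = "(\<lambda>a. a \<cdot> \<Omega>) ` N"
  have V: "0 \<in> ?V" "\<And>v w. v \<in> ?V \<Longrightarrow> w \<in> ?V \<Longrightarrow> v + w \<in> ?V" "\<And>c v. v \<in> ?V \<Longrightarrow> c *\<^sub>C v \<in> ?V"
    using N_closed(2,5,8) by (auto simp: image_iff simp flip: bop_apply_simps(2) scaleC_bop_apply)
      (metis bop_apply_simps(5))
  then have "subspace ?V" by (auto simp: subspace_def simp flip: scaleC_of_real)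
  then have "subspace (closure ?V)" by (rule subspace_closure)
  then have "projection (projection_onto (closure ?V)) \<and> range (bop_apply (projection_onto (closure ?V))) = closure ?V"
    using V(3) by (intro ex_projection_onto) (auto intro: subspace_0 subspace_add scaleC_closure)
  then show "projection p" "range (bop_apply p) = closure ?V"
    by (simp_all add: jones_projection_def)
qed

lemma adj_p [simp]: "adj p = p" and p_idem [simp]: "p * p = p"
  using p_projection by (simp_all add: projection_def)

lemma p_fixes: "v \<in> closure ((\<lambda>a. a \<cdot> \<Omega>) ` N) \<Longrightarrow> p \<cdot> v = v"
  unfolding range_p[symmetric] using p_idem by (metis bop_apply_simps(1) imageE)

lemma p_Omega [simp]: "p \<cdot> \<Omega> = \<Omega>"
proof (rule p_fixes)
  have "1 \<cdot> \<Omega> \<in> (\<lambda>a. a \<cdot> \<Omega>) ` N" by (rule imageI[OF N_closed(1)])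
  then have "1 \<cdot> \<Omega> \<in> closure ((\<lambda>a. a \<cdot> \<Omega>) ` N)" by (rule subsetD[OF closure_subset])
  then show "\<Omega> \<in> closure ((\<lambda>a. a \<cdot> \<Omega>) ` N)" by simp
qed

text \<open>\<open>p\<close> fixes \<open>\<Omega>\<close>, and \<open>\<Omega>\<close> is
  separating for \<open>M\<close>.\<close>

lemma p_separating:
  assumes "a \<in> M" "b \<in> M" "a * p = b * p"
  shows "a = b"
proof -
  have "(a * p) \<cdot> \<Omega> = (b * p) \<cdot> \<Omega>" by (simp only: assms(3))
  then have "(a - b) \<cdot> \<Omega> = 0" by simp
  then have "a - b = 0" by (rule Omega_separating[OF M_closed(6)[OF assms(1,2)]])
  then show ?thesis by simp
qed

text \<open>The closure of the orbit of \<open>\<Omega>\<close> under \<open>N\<close> is invariant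
  under \<open>n\<close> and under \<open>adj n\<close>; the second invariance is used in adjoint
  form.\<close>

lemma p_commute:
  assumes "n \<in> N"
  shows "n * p = p * n"
proof -
  have *: "p * (n * p) = n * p" if n: "n \<in> N" for n
  proof (rule bop_eqI)
    fix v
    let ?V = "(\<lambda>a. a \<cdot> \<Omega>) ` N"
    have "bop_apply n ` closure ?V \<subseteq> closure (bop_apply n ` ?V)"
      by (rule closure_bounded_linear_image_subset[OF bounded_linear_bop_apply])
    also have "\<dots> \<subseteq> closure ?V"
      using N_closed(4)[OF n] by (intro closure_mono) (auto simp: image_iff simp flip: bop_apply_simps(1))
    finally have "n \<cdot> p \<cdot> v \<in> closure ?V" using range_p by blast
    then show "(p * (n * p)) \<cdot> v = (n * p) \<cdot> v" by (simp add: p_fixes)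
  qed
  have "p * n = p * n * p" using arg_cong[OF *[OF N_closed(3)[OF assms]], of adj] by (simp add: mult.assoc)
  then show ?thesis using *[OF assms] by (simp add: mult.assoc)
qed

text \<open>On vectors \<open>n \<cdot> \<Omega>\<close> and \<open>k \<cdot> \<Omega>\<close> with
  \<open>n\<close>, \<open>k\<close> in \<open>N\<close>, the form of \<open>a\<close> is the real
  part of \<open>\<tau> (adj k * a * n)\<close>. Trace preservation and the bimodule property
  replace \<open>a\<close> by \<open>E a = 0\<close>; density extends this to the range of
  \<open>p\<close>.\<close>

lemma p_compress_kernel:
  assumes a: "a \<in> M" "E a = 0"
  shows "p * a * p = 0"
proof -
  let ?V = "(\<lambda>a. a \<cdot> \<Omega>) ` N"
  have VV: "inner (a \<cdot> s) t = 0" if "s \<in> ?V" "t \<in> ?V" for s t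
  proof -
    obtain n k where nk: "n \<in> N" "s = n \<cdot> \<Omega>" "k \<in> N" "t = k \<cdot> \<Omega>" using \<open>s \<in> ?V\<close> \<open>t \<in> ?V\<close> by blast
    have "inner (a \<cdot> s) t = Re (\<tau> (adj k * (a * n)))"
      using inner_Omega[of "a * n" k] nk a NM by (simp add: M_closed)
    also have "\<tau> (adj k * (a * n)) = \<tau> (E (adj k * a * n))"
      using nk a NM by (simp add: trace_E M_closed mult.assoc)
    also have "E (adj k * a * n) = 0"
      using nk a by (simp add: E_bimodule N_closed)
    finally show ?thesis by (simp add: trace_0)
  qed
  have "p \<cdot> a \<cdot> p \<cdot> v = 0" for v
  proof -
    have "inner (a \<cdot> p \<cdot> v) (p \<cdot> w) = 0" for w
    proof -
      have p: "p \<cdot> v \<in> closure ?V" for v using range_p by blast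
      have "inner (a \<cdot> s) (p \<cdot> w) = 0" if "s \<in> ?V" for s
        by (rule inner_closure_eq_0[OF p]) (rule VV[OF that])
      then have "inner (adj a \<cdot> p \<cdot> w) (p \<cdot> v) = 0"
        by (intro inner_closure_eq_0[OF p]) (simp add: inner_adj_left inner_commute[of "p \<cdot> w"])
      then show ?thesis by (simp add: inner_adj_left inner_commute[of "p \<cdot> w"])
    qed
    then have "inner (p \<cdot> a \<cdot> p \<cdot> v) w = 0" for w using inner_adj[of p] by simp
    then show ?thesis using inner_eq_zero_iff by blast
  qed
  then show ?thesis by (intro bop_eqI) (simp add: mult.assoc)
qed

text \<open>Split \<open>a\<close> into \<open>E a\<close>, which commutes with \<open>p\<close>,
  and a remainder in the kernel of \<open>E\<close>.\<close>

lemma p_compress: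
  assumes a: "a \<in> M"
  shows "p * a * p = E a * p"
proof -
  have Ea: "E a \<in> N" using a by (rule E_mem)
  have "p * (a - E a) * p = 0"
    using a Ea NM by (intro p_compress_kernel) (simp_all add: M_closed E_diff E_N)
  moreover have "p * E a * p = E a * p"
    using p_commute[OF Ea] by (metis mult.assoc p_idem)
  ultimately show ?thesis by (simp add: algebra_simps)
qed

section \<open>Geodesics of the projection manifold and of the orbit\<close>

text \<open>Co-diagonality of the generator comes from \<open>p * x * p = 0\<close> and its
  adjoint.\<close>

lemma geodesic_of_projections_codiagonal:
  assumes x: "x \<in> M" "E x = 0"
  shows "geodesic_of_projections (jones_extension M p) p (conj_curve (x * p - p * adj x) p)"
  unfolding geodesic_of_projections_def
proof (intro bexI conjI)
  let ?w = "x * p - p * adj x"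
  have pxp: "p * x * p = 0" using x by (rule p_compress_kernel)
  have pxp': "p * adj x * p = 0" using arg_cong[OF pxp, of adj] by (simp add: mult.assoc)
  show "adj ?w = - ?w" by simp
  show "?w = ?w * p + p * ?w"
    using pxp pxp' by (simp add: algebra_simps) (metis mult.assoc p_idem)
  show "?w \<in> jones_extension M p"
    unfolding jones_extension_def vN_generated_def
  proof (intro InterI)
    fix A assume "A \<in> {A. von_neumann_algebra A \<and> insert p M \<subseteq> A}"
    then have A: "von_neumann_algebra A" "p \<in> A" "x \<in> A" using x by auto
    then show "?w \<in> A" by (simp add: von_neumann_algebra_closed[OF A(1)])
  qed
qed simp

text \<open>
  Comparing the first and second derivatives at \<open>0\<close> of two equal curves identifies the generator
  with \<open>x\<close> and then yields \<open>x\<^sup>2 p = p x\<^sup>2 p\<close>.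
\<close>

lemma geodesic_of_orbit_imp:
  assumes x: "x \<in> M" "E x = 0"
    and "geodesic_of_orbit M E p (conj_curve (x * p - p * adj x) p)"
  shows "adj x = - x" and "x * x \<in> N"
proof -
  let ?w = "x * p - p * adj x"
  obtain z where z: "z \<in> M" "adj z = - z" "E z = 0" and eq: "conj_curve z p = conj_curve ?w p"
    using assms(3) unfolding geodesic_of_orbit_def by metis
  have xxM: "x * x \<in> M" using x(1) by (simp add: M_closed)
  have pxp: "p * (x * p) = 0" and pzp: "p * (z * p) = 0"
    using p_compress_kernel x z by (simp_all add: mult.assoc)
  have pxp': "p * (adj x * p) = 0" using arg_cong[OF pxp, of adj] by (simp add: mult.assoc)
  have pp: "p * (p * a) = p * a" for a by (metis mult.assoc p_idem)
  note eq1 = conj_curve_eq_imp_commutator_eq[OF eq]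
  from fun_cong[OF eq1, of 0] have c1: "z * p - p * z = ?w * p - p * ?w" by simp
  \<comment> \<open>Right multiplication by \<open>p\<close> leaves \<open>z * p\<close> and
    \<open>x * p\<close>, since all compressions by \<open>p\<close> on both sides vanish.\<close>
  then have "(z * p - p * z) * p = (?w * p - p * ?w) * p" by simp
  then have "z * p = x * p"
    by (simp add: left_diff_distrib right_diff_distrib distrib_left distrib_right mult.assoc pxp pxp' pzp pp)
  then have zx: "z = x" by (rule p_separating[OF z(1) x(1)])
  then show skew: "adj x = - x" using z(2) by simp
  from fun_cong[OF conj_curve_eq_imp_commutator_eq[OF eq1], of 0]
  have "(x * (x * p - p * x) - (x * p - p * x) * x) * p
      = (?w * (?w * p - p * ?w) - (?w * p - p * ?w) * ?w) * p"
    by (simp add: zx)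
  \<comment> \<open>The two double commutators, cut by \<open>p\<close> on the right, differ only in
    that \<open>x * x * p\<close> stands in place of one copy of
    \<open>p * x * x * p\<close>.\<close>
  moreover have "(x * (x * p - p * x) - (x * p - p * x) * x) * p = x * x * p + p * (x * (x * p))"
    by (simp add: left_diff_distrib right_diff_distrib mult.assoc pxp)
  moreover have "(?w * (?w * p - p * ?w) - (?w * p - p * ?w) * ?w) * p = p * (x * (x * p)) + p * (x * (x * p))"
  proof -
    have a: "p * (x * (p * b)) = 0" for b
      using arg_cong[OF pxp, of "\<lambda>c. c * b"] by (simp add: mult.assoc)
    show ?thesis
      unfolding skew
      by (simp add: left_diff_distrib right_diff_distrib distrib_left distrib_right mult.assoc pp pxp a)
  qed
  ultimately have "x * x * p = p * (x * x) * p" by (simp add: mult.assoc)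
  also have "\<dots> = E (x * x) * p" by (rule p_compress[OF xxM])
  finally have "x * x = E (x * x)" by (rule p_separating[OF xxM NM[OF E_mem[OF xxM]]])
  then show "x * x \<in> N" using E_mem[OF xxM] by simp
qed

text \<open>
  The corner \<open>d = (1 - p) x (1 - p)\<close> of \<open>x\<close> annihilates the co-diagonal part of \<open>x\<close> as soon as
  \<open>x\<^sup>2\<close> commutes with \<open>p\<close>.
\<close>

lemma conj_curve_codiagonal_eq:
  assumes x: "x \<in> M" "E x = 0" and skew: "adj x = - x" and sq: "x * x \<in> N"
  shows "conj_curve (x * p - p * adj x) p = conj_curve x p"
proof
  fix t
  \<comment> \<open>This is the corner of \<open>x\<close> at \<open>1 - p\<close>, because
    \<open>p * x * p = 0\<close>.\<close>
  define d where "d = x - (x * p + p * x)"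
  have pxp: "p * (x * p) = 0" using p_compress_kernel x by (simp add: mult.assoc)
  have a: "p * (x * (p * b)) = 0" for b
    using arg_cong[OF pxp, of "\<lambda>c. c * b"] by (simp add: mult.assoc)
  have pp: "p * (p * b) = p * b" for b by (metis mult.assoc p_idem)
  have xx: "x * (x * p) = p * (x * x)" using p_commute[OF sq] by (simp add: mult.assoc)
  have xx': "x * (x * (p * b)) = p * (x * (x * b))" for b
    using arg_cong[OF xx, of "\<lambda>c. c * b"] by (simp add: mult.assoc)
  have "conj_curve ((x * p + p * x) + d) p t = conj_curve (x * p + p * x) p t"
    by (rule conj_curve_orthogonal_summand)
      (simp_all add: d_def left_diff_distrib right_diff_distrib distrib_left distrib_right mult.assoc
        pp pxp a xx xx')
  then show "conj_curve (x * p - p * adj x) p t = conj_curve x p t"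
    by (simp add: d_def skew)
qed

text \<open>The bimodule property gives \<open>E u * abs_op x = E x = 0\<close>, so
  \<open>E u\<close> vanishes on the range of the modulus. It vanishes on the kernel because
  \<open>E u = E u * (adj u * u)\<close>.\<close>

lemma polar_part_kernel_mem:
  assumes x: "x \<in> M" "E x = 0" and u: "polar_part x u" and h: "abs_op x \<in> N"
  shows "adj u * u \<in> N" and "E u = 0"
proof -
  show q: "adj u * u \<in> N"
    by (rule von_neumann_algebraI_commute[OF N], rule polar_part_initial_projection[OF u])
      (rule commutantD[OF _ h])
  have uM: "u \<in> M" using M x(1) u by (rule polar_part_mem)
  show "E u = 0"
  proof (rule bop_eq_0_if_selfadjoint[of "abs_op x"])
    show "E u * abs_op x = 0"
      using E_bimodule[OF uM N_closed(1) h] u x(2) by (simp add: polar_part_def)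
  next
    fix v assume "abs_op x \<cdot> v = 0"
    then have uv: "u \<cdot> v = 0" by (simp add: polar_part_kernel[OF u])
    have "E u = E (1 * u * (adj u * u))" using polar_part_initial_projection(2)[OF u] by simp
    also have "\<dots> = E u * (adj u * u)" unfolding E_bimodule[OF uM N_closed(1) q] by simp
    finally have "E u \<cdot> v = (E u * (adj u * u)) \<cdot> v" by (rule arg_cong)
    also have "\<dots> = 0" by (simp add: uv)
    finally show "E u \<cdot> v = 0" .
  qed simp
qed

end

theorem theorem6p3:
  fixes M N :: "'a :: complex_hilbert bop set"
    and \<tau> :: "'a bop \<Rightarrow> complex" and \<Omega> :: 'a and E :: "'a bop \<Rightarrow> 'a bop"
    and p x :: "'a bop" and \<gamma> :: "real \<Rightarrow> 'a bop"
  assumes "II1_factor M" and "II1_factor N" and "N \<subseteq> M"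
    and "normalized_trace M \<tau>" and "standard_L2 M \<tau> \<Omega>"
    and "jones_index N < \<infinity>"
    and "trace_preserving_expectation M N \<tau> E"
    and "x \<in> expectation_kernel M E"
  defines "p \<equiv> jones_projection N \<Omega>"
  defines "\<gamma> \<equiv> (\<lambda>t. exp (t *\<^sub>R (x * p - p * adj x)) * p * exp (- (t *\<^sub>R (x * p - p * adj x))))"
  shows "geodesic_of_projections (jones_extension M p) p \<gamma> \<and>
    (geodesic_of_orbit M E p \<gamma> \<longleftrightarrow> adj x = - x \<and> x\<^sup>2 \<in> N) \<and>
    (geodesic_of_orbit M E p \<gamma> \<longrightarrow>
      (\<exists>u. polar_part x u \<and> u \<in> expectation_kernel M E \<and> adj u = - u \<and>
          adj u * u = u * adj u \<and> u * adj u = - u\<^sup>2 \<and> - u\<^sup>2 \<in> N \<and>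
          abs_op x = sqrt_op (- x\<^sup>2) \<and> abs_op x \<in> N \<and>
          (\<forall>t. \<gamma> t = exp (t *\<^sub>R x) * p * exp (- (t *\<^sub>R x)) \<and>
               \<gamma> t = p * (cos (t *\<^sub>R abs_op x))\<^sup>2
                   + u * p * adj u * (sin (t *\<^sub>R abs_op x))\<^sup>2
                   + (1/2) *\<^sub>R ((u * p - p * u) * sin ((2 * t) *\<^sub>R abs_op x)))))"
proof -
  interpret standard_inclusion M N \<tau> \<Omega> E
    using assms(1-5,7) by unfold_locales (auto simp: II1_factor_def factor_def)
  have x: "x \<in> M" "E x = 0" using assms(8) by (auto simp: expectation_kernel_def)
  have \<gamma>: "\<gamma> = conj_curve (x * p - p * adj x) p"
    by (simp add: \<gamma>_def conj_curve_def fun_eq_iff)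
  have \<gamma>_x: "\<gamma> = conj_curve x p" if "adj x = - x" "x * x \<in> N"
    using conj_curve_codiagonal_eq[OF x that] by (simp add: \<gamma> p_def)
  have geo: "geodesic_of_projections (jones_extension M p) p \<gamma>"
    using geodesic_of_projections_codiagonal[OF x] by (simp add: \<gamma> p_def)
  have orbit: "geodesic_of_orbit M E p \<gamma> \<longleftrightarrow> adj x = - x \<and> x\<^sup>2 \<in> N"
  proof
    assume "geodesic_of_orbit M E p \<gamma>"
    then show "adj x = - x \<and> x\<^sup>2 \<in> N"
      using geodesic_of_orbit_imp[OF x] by (simp add: \<gamma> p_def power2_eq_square)
  next
    assume "adj x = - x \<and> x\<^sup>2 \<in> N"
    then show "geodesic_of_orbit M E p \<gamma>"
      unfolding geodesic_of_orbit_def using x \<gamma>_x by (auto simp: power2_eq_square)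
  qed
  have "\<exists>u. polar_part x u \<and> u \<in> expectation_kernel M E \<and> adj u = - u \<and>
      adj u * u = u * adj u \<and> u * adj u = - u\<^sup>2 \<and> - u\<^sup>2 \<in> N \<and>
      abs_op x = sqrt_op (- x\<^sup>2) \<and> abs_op x \<in> N \<and>
      (\<forall>t. \<gamma> t = exp (t *\<^sub>R x) * p * exp (- (t *\<^sub>R x)) \<and>
           \<gamma> t = p * (cos (t *\<^sub>R abs_op x))\<^sup>2
               + u * p * adj u * (sin (t *\<^sub>R abs_op x))\<^sup>2
               + (1/2) *\<^sub>R ((u * p - p * u) * sin ((2 * t) *\<^sub>R abs_op x)))"
    if "adj x = - x" "x * x \<in> N"
  proof -
    obtain u where u: "polar_part x u" by (rule polar_decomposition)
    have xx: "adj x * x = - (x * x)" by (simp add: that(1))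
    \<comment> \<open>The square of the modulus is \<open>- (x * x)\<close>, an element of
      \<open>N\<close>, and the modulus lies in the bicommutant of its square.\<close>
    have h: "abs_op x \<in> N"
      using N_closed(7)[OF that(2)] by (intro abs_op_mem N) (simp add: xx)
    note mem = polar_part_kernel_mem[OF x u h] and skew = polar_part_skew[OF u that(1)]
    have xuh: "x = u * abs_op x" using u by (simp add: polar_part_def)
    have curve: "conj_curve x p t = p * (cos (t *\<^sub>R abs_op x))\<^sup>2
        + u * p * adj u * (sin (t *\<^sub>R abs_op x))\<^sup>2
        + (1/2) *\<^sub>R ((u * p - p * u) * sin ((2 * t) *\<^sub>R abs_op x))" for t
    proof -
      \<comment> \<open>Both sides equal \<open>x * x\<close>. The sign of the
        \<open>u * p * u\<close> term in \<open>conj_curve_polar\<close> is then absorbed by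
        \<open>adj u = - u\<close>.\<close>
      have "(u * abs_op x) * (u * abs_op x) = - (abs_op x * abs_op x)"
        using xx abs_op_square[of x] by (simp flip: xuh)
      moreover have "p * abs_op x = abs_op x * p" using p_commute[OF h] by (simp add: p_def)
      ultimately show ?thesis
        using conj_curve_polar[OF skew(1), of p t] skew(2) by (simp flip: xuh)
    qed
    show ?thesis
    proof (intro exI[of _ u] conjI allI)
      show "u \<in> expectation_kernel M E"
        using mem(2) polar_part_mem[OF M x(1) u] by (simp add: expectation_kernel_def)
      show "adj u * u = u * adj u" "u * adj u = - u\<^sup>2" "- u\<^sup>2 \<in> N"
        using mem(1) skew(2) by (simp_all add: power2_eq_square)
      show "abs_op x = sqrt_op (- x\<^sup>2)"
        by (simp add: abs_op_def xx power2_eq_square)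
      show "\<gamma> t = exp (t *\<^sub>R x) * p * exp (- (t *\<^sub>R x))" for t
        by (simp add: \<gamma>_x[OF that] conj_curve_def)
      show "\<gamma> t = p * (cos (t *\<^sub>R abs_op x))\<^sup>2 + u * p * adj u * (sin (t *\<^sub>R abs_op x))\<^sup>2
          + (1/2) *\<^sub>R ((u * p - p * u) * sin ((2 * t) *\<^sub>R abs_op x))" for t
        by (simp only: \<gamma>_x[OF that] curve)
    qed (use u skew h in auto)
  qed
  with geo orbit show ?thesis by (simp add: power2_eq_square)
qed

end
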